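(* A Sasakian manifold $(M,\xi,\eta,\Phi,g)$ of dimension $2n+1\geq 5$ admits both the Einstein-Weyl structures $\mathcal{W}^{+}=(g,\theta)$ and $\mathcal{W}^{-}=(g,-\theta)$ for some 1-form $\theta$ if and only if it is $\eta$-Einstein with Einstein constants $(\lambda,\nu)$ such that $\nu<0$.
   Context: A Sasakian structure $(\xi,\eta,\Phi,g)$ on a manifold $M$ of dimension $2n+1$ consists of a vector field $\xi$, a 1-form $\eta$, a $(1,1)$-tensor field $\Phi$ and a Riemannian metric $g$ with $\eta(\xi)=1$, $\Phi^2X=-X+\eta(X)\xi$, $g(\Phi X,\Phi Y)=g(X,Y)-\eta(X)\eta(Y)$, such that $\eta$ is a contact form and the metric cone $(\mathbb{R}^+\times M,\,dr^2+r^2g,\,d(r^2\eta))$ is Kähler; equivalently $(\nabla_X\Phi)Y=g(X,Y)\xi-\eta(Y)X$. It is $\eta$-Einstein with constants $(\lambda,\nu)$ if $\mathrm{Ric}_g=\lambda g+\nu\,\eta\otimes\eta$ for real constants $\lambda,\nu$. A Weyl structure $\mathcal{W}=(g,\theta)$ on $M$ is given by a Riemannian metric $g$ and a 1-form $\theta$; its Weyl connection $D$ is the unique torsion-free connection with $Dg=-2\theta\otimes g$, i.e. $D_XY=\nabla_XY+\theta(X)Y+\theta(Y)X-g(X,Y)\theta^\#$, where $\nabla$ is the Levi-Civita connection of $g$ and $\theta^\#$ is the $g$-dual vector field of $\theta$. It is Einstein-Weyl if $\mathrm{Ric}^D(X,Y)+\mathrm{Ric}^D(Y,X)=\Lambda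 g(X,Y)$ for some smooth function $\Lambda$ on $M$, where $\mathrm{Ric}^D$ is the Ricci tensor of $D$.
   Formalization: The 1-form θ is required to be not identically zero (with θ = 0 the round 5-sphere, where ν = 0, is a counterexample), and M is taken connected (else the constants may differ between components) and non-empty. *)

theory Defs
  imports "HOL-Analysis.Analysis"
begin

subsection \<open>Smooth maps between Euclidean spaces\<close>

text \<open>
  These notions are meant for open \<open>S\<close>. As the domain is finite-dimensional, continuity of all
  iterated directional derivatives is continuity of all iterated Frechet derivatives.
\<close>

primrec Ck_on :: "nat \<Rightarrow> ('e::euclidean_space \<Rightarrow> 'f::real_normed_vector) \<Rightarrow> 'e set \<Rightarrow> bool" where
  "Ck_on 0 f S \<longleftrightarrow> continuous_on S f"
| "Ck_on (Suc k) f S \<longleftrightarrow>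
     (\<forall>x\<in>S. f differentiable (at x)) \<and> (\<forall>v. Ck_on k (\<lambda>x. frechet_derivative f (at x) v) S)"

definition smooth_on :: "('e::euclidean_space \<Rightarrow> 'f::real_normed_vector) \<Rightarrow> 'e set \<Rightarrow> bool" where
  "smooth_on f S \<longleftrightarrow> (\<forall>k. Ck_on k f S)"


subsection \<open>Smooth manifolds\<close>

text \<open>
  The underlying set is \<open>topspace M\<close>; a chart is a coordinate domain together with a coordinate map
  into the model space, and \<open>DIM('e)\<close> is the dimension of the manifold.
\<close>

type_synonym ('a, 'e) chart = "'a set \<times> ('a \<Rightarrow> 'e)"

definition coords :: "('a, 'e) chart \<Rightarrow> 'e set" where
  "coords c = snd c ` fst c"

definition param :: "('a, 'e) chart \<Rightarrow> 'e \<Rightarrow> 'a" where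
  "param c = inv_into (fst c) (snd c)"

definition is_chart :: "'a topology \<Rightarrow> ('a, 'e::euclidean_space) chart \<Rightarrow> bool" where
  "is_chart M c \<longleftrightarrow> openin M (fst c) \<and> open (coords c) \<and>
     homeomorphic_map (subtopology M (fst c)) (top_of_set (coords c)) (snd c)"

definition overlap :: "('a, 'e) chart \<Rightarrow> ('a, 'e) chart \<Rightarrow> 'e set" where
  "overlap c d = snd c ` (fst c \<inter> fst d)"

definition transition :: "('a, 'e) chart \<Rightarrow> ('a, 'e) chart \<Rightarrow> 'e \<Rightarrow> 'e" where
  "transition c d = snd d \<circ> param c"

definition smooth_manifold :: "'a topology \<Rightarrow> ('a, 'e::euclidean_space) chart set \<Rightarrow> bool" where
  "smooth_manifold M A \<longleftrightarrow> Hausdorff_space M \<and> second_countable M \<and>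
     (\<forall>c\<in>A. is_chart M c) \<and> \<Union> (fst ` A) = topspace M \<and>
     (\<forall>c\<in>A. \<forall>d\<in>A. smooth_on (transition c d) (overlap c d))"

definition smooth_function :: "('a, 'e::euclidean_space) chart set \<Rightarrow> ('a \<Rightarrow> real) \<Rightarrow> bool" where
  "smooth_function A f \<longleftrightarrow> (\<forall>c\<in>A. smooth_on (f \<circ> param c) (coords c))"


subsection \<open>Tensor fields\<close>

text \<open>
  A tensor field is given by its components in each chart of the atlas, as functions on the
  coordinate domain, subject to the transformation law on overlaps. The atlas need not be maximal:
  components in the remaining charts of the smooth structure are determined by this law.
  Values outside \<open>coords c\<close> carry no meaning and are never used.
\<close>

type_synonym ('a, 'e) vfield = "('a, 'e) chart \<Rightarrow> 'e \<Rightarrow> 'e"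
type_synonym ('a, 'e) form1 = "('a, 'e) chart \<Rightarrow> 'e \<Rightarrow> 'e \<Rightarrow> real"
type_synonym ('a, 'e) endofield = "('a, 'e) chart \<Rightarrow> 'e \<Rightarrow> 'e \<Rightarrow> 'e"
type_synonym ('a, 'e) bilfield = "('a, 'e) chart \<Rightarrow> 'e \<Rightarrow> 'e \<Rightarrow> 'e \<Rightarrow> real"

abbreviation dtrans :: "('a, 'e::euclidean_space) chart \<Rightarrow> ('a, 'e) chart \<Rightarrow> 'e \<Rightarrow> 'e \<Rightarrow> 'e" where
  "dtrans c d x \<equiv> frechet_derivative (transition c d) (at x)"

definition vector_field ::
    "('a, 'e::euclidean_space) chart set \<Rightarrow> ('a, 'e) vfield \<Rightarrow> bool" where
  "vector_field A X \<longleftrightarrow>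
     (\<forall>c\<in>A. smooth_on (X c) (coords c)) \<and>
     (\<forall>c\<in>A. \<forall>d\<in>A. \<forall>x\<in>overlap c d. X d (transition c d x) = dtrans c d x (X c x))"

definition one_form ::
    "('a, 'e::euclidean_space) chart set \<Rightarrow> ('a, 'e) form1 \<Rightarrow> bool" where
  "one_form A \<alpha> \<longleftrightarrow>
     (\<forall>c\<in>A. \<forall>x\<in>coords c. linear (\<alpha> c x)) \<and>
     (\<forall>c\<in>A. \<forall>v. smooth_on (\<lambda>x. \<alpha> c x v) (coords c)) \<and>
     (\<forall>c\<in>A. \<forall>d\<in>A. \<forall>x\<in>overlap c d. \<forall>v. \<alpha> d (transition c d x) (dtrans c d x v) = \<alpha> c x v)"

definition endo_field ::
    "('a, 'e::euclidean_space) chart set \<Rightarrow> ('a, 'e) endofield \<Rightarrow> bool" where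
  "endo_field A F \<longleftrightarrow>
     (\<forall>c\<in>A. \<forall>x\<in>coords c. linear (F c x)) \<and>
     (\<forall>c\<in>A. \<forall>v. smooth_on (\<lambda>x. F c x v) (coords c)) \<and>
     (\<forall>c\<in>A. \<forall>d\<in>A. \<forall>x\<in>overlap c d. \<forall>v.
        F d (transition c d x) (dtrans c d x v) = dtrans c d x (F c x v))"

definition riemannian_metric ::
    "('a, 'e::euclidean_space) chart set \<Rightarrow> ('a, 'e) bilfield \<Rightarrow> bool" where
  "riemannian_metric A g \<longleftrightarrow>
     (\<forall>c\<in>A. \<forall>x\<in>coords c. bilinear (g c x) \<and> (\<forall>u v. g c x u v = g c x v u) \<and>
        (\<forall>v. v \<noteq> 0 \<longrightarrow> g c x v v > 0)) \<and>
     (\<forall>c\<in>A. \<forall>u v. smooth_on (\<lambda>x. g c x u v) (coords c)) \<and>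
     (\<forall>c\<in>A. \<forall>d\<in>A. \<forall>x\<in>overlap c d. \<forall>u v.
        g d (transition c d x) (dtrans c d x u) (dtrans c d x v) = g c x u v)"


subsection \<open>Connections and curvature in a chart\<close>

text \<open>
  A connection is given in a chart by \<open>\<Gamma>\<close>, with \<open>\<Gamma> x u v\<close> the covariant derivative at \<open>x\<close> of the
  constant coordinate field \<open>v\<close> in direction \<open>u\<close>, so that the covariant derivative of a field \<open>Y\<close> is
  \<open>frechet_derivative Y (at x) u + \<Gamma> x u (Y x)\<close>. Constant coordinate fields commute, hence \<open>\<Gamma>\<close> is
  torsion-free iff it is symmetric. In this subsection all tensors are already restricted to one
  chart.
\<close>

definition cov_metric ::
    "('e::euclidean_space \<Rightarrow> 'e \<Rightarrow> 'e \<Rightarrow> real) \<Rightarrow> 'e \<Rightarrow> ('e \<Rightarrow> 'e \<Rightarrow> 'e) \<Rightarrow> 'e \<Rightarrow> 'e \<Rightarrow> 'e \<Rightarrow> real" where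
  "cov_metric g x G w u v =
     frechet_derivative (\<lambda>y. g y u v) (at x) w - g x (G w u) v - g x u (G w v)"

definition cov_endo ::
    "('e::euclidean_space \<Rightarrow> 'e \<Rightarrow> 'e) \<Rightarrow> 'e \<Rightarrow> ('e \<Rightarrow> 'e \<Rightarrow> 'e) \<Rightarrow> 'e \<Rightarrow> 'e \<Rightarrow> 'e" where
  "cov_endo F x G w v =
     frechet_derivative (\<lambda>y. F y v) (at x) w + G w (F x v) - F x (G w v)"

definition levi_civita ::
    "('e::euclidean_space \<Rightarrow> 'e \<Rightarrow> 'e \<Rightarrow> real) \<Rightarrow> 'e \<Rightarrow> 'e \<Rightarrow> 'e \<Rightarrow> 'e" where
  "levi_civita g x = (THE G. bilinear G \<and> (\<forall>u v. G u v = G v u) \<and>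
     (\<forall>w u v. cov_metric g x G w u v = 0))"

definition weyl_connection ::
    "('e::euclidean_space \<Rightarrow> 'e \<Rightarrow> 'e \<Rightarrow> real) \<Rightarrow> ('e \<Rightarrow> 'e \<Rightarrow> real) \<Rightarrow> 'e \<Rightarrow> 'e \<Rightarrow> 'e \<Rightarrow> 'e" where
  "weyl_connection g \<theta> x = (THE G. bilinear G \<and> (\<forall>u v. G u v = G v u) \<and>
     (\<forall>w u v. cov_metric g x G w u v = - 2 * \<theta> x w * g x u v))"

lemma ex1_christoffel:
  fixes B :: "'e::euclidean_space \<Rightarrow> 'e \<Rightarrow> real" and T :: "'e \<Rightarrow> 'e \<Rightarrow> 'e \<Rightarrow> real"
  assumes B: "bilinear B" "\<And>u v. B u v = B v u" "\<And>v. v \<noteq> 0 \<Longrightarrow> B v v > 0"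
    and T: "\<And>u v. linear (\<lambda>w. T w u v)" "\<And>w v. linear (\<lambda>u. T w u v)" "\<And>w u v. T w u v = T w v u"
  shows "\<exists>!G. bilinear G \<and> (\<forall>u v. G u v = G v u) \<and>
           (\<forall>w u v. T w u v = B (G w u) v + B u (G w v))"
proof -
  have linB: "linear (B w)" "linear (\<lambda>w. B w v)" for w v
    using B(1) by (auto simp: bilinear_def)
  have inj: "w = w'" if "\<And>z. B w z = B w' z" for w w'
  proof -
    have "B (w - w') (w - w') = 0"
      using that[of "w - w'"] linear_diff[OF linB(2)] by simp
    then show ?thesis using B(3)[of "w - w'"] by fastforce
  qed
  define L where "L w = (\<Sum>b\<in>Basis. B w b *\<^sub>R b)" for w
  have linL: "linear L"
    unfolding L_def
    by (rule linearI)
       (simp_all add: linear_add[OF linB(2)] linear_scale[OF linB(2)] algebra_simps sum.distrib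
          scaleR_sum_right)
  have Lin: "L w \<bullet> z = B w z" for w z
  proof -
    have "B w z = B w (\<Sum>b\<in>Basis. (z \<bullet> b) *\<^sub>R b)" by (simp add: euclidean_representation)
    also have "\<dots> = (\<Sum>b\<in>Basis. (z \<bullet> b) * B w b)"
      by (simp add: linear_sum[OF linB(1)] linear_scale[OF linB(1)])
    also have "\<dots> = L w \<bullet> z"
      by (simp add: L_def inner_sum_left inner_commute[of z] mult.commute)
    finally show ?thesis by simp
  qed
  have "inj L"
  proof (rule injI, rule inj)
    show "B w z = B w' z" if "L w = L w'" for w w' z
      using that Lin[of w z] Lin[of w' z] by simp
  qed
  then have "surj L" by (simp add: linear_injective_imp_surjective[OF linL])
  have riesz: "\<exists>w. \<forall>z. B w z = f z" if "linear f" for f :: "'e \<Rightarrow> real"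
  proof -
    obtain w where w: "L w = (\<Sum>b\<in>Basis. f b *\<^sub>R b)" using \<open>surj L\<close> by (metis surjD)
    have "B w z = f z" for z
    proof -
      have "f z = f (\<Sum>b\<in>Basis. (z \<bullet> b) *\<^sub>R b)" by (simp add: euclidean_representation)
      also have "\<dots> = (\<Sum>b\<in>Basis. (z \<bullet> b) * f b)"
        by (simp add: linear_sum[OF that] linear_scale[OF that])
      also have "\<dots> = L w \<bullet> z"
        by (simp add: w inner_sum_left inner_commute[of z] mult.commute)
      finally show ?thesis by (simp add: Lin)
    qed
    then show ?thesis by blast
  qed
  have linT: "linear (\<lambda>v. T w u v)" for w u
    using T(2)[of w u] by (simp add: T(3)[of w u])
  define K where "K w u z = (T w u z + T u w z - T z w u) / 2" for w u z
  have Tadd: "T (a + b) u v = T a u v + T b u v" "T w (a + b) v = T w a v + T w b v"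
    "T w u (a + b) = T w u a + T w u b" for a b u v w
    using linear_add[OF T(1)] linear_add[OF T(2)] linear_add[OF linT] by auto
  have Tsc: "T (r *\<^sub>R b) u v = r * T b u v" "T w (r *\<^sub>R b) v = r * T w b v"
    "T w u (r *\<^sub>R b) = r * T w u b" for r b u v w
    using linear_scale[OF T(1)] linear_scale[OF T(2)] linear_scale[OF linT] by auto
  have "linear (K w u)" for w u
    unfolding K_def by (rule linearI) (simp_all add: Tadd Tsc algebra_simps add_divide_distrib diff_divide_distrib)
  then have "\<exists>a. \<forall>z. B a z = K w u z" for w u by (rule riesz)
  then have G: "B (SOME a. \<forall>z. B a z = K w u z) z = K w u z" for w u z
    using someI_ex[of "\<lambda>a. \<forall>z. B a z = K w u z"] by simp
  define G where "G w u = (SOME a. \<forall>z. B a z = K w u z)" for w u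
  note G = G[folded G_def]
  show ?thesis
  proof (rule ex1I[of _ G], intro conjI allI)
    show "bilinear G"
      unfolding bilinear_def
      by (intro conjI allI linearI; rule inj;
          simp add: G linear_add[OF linB(2)] linear_scale[OF linB(2)] K_def Tadd Tsc algebra_simps
            add_divide_distrib diff_divide_distrib)
    show "G u v = G v u" for u v
      by (rule inj) (simp add: G K_def T(3)[of _ u v])
    show "T w u v = B (G w u) v + B u (G w v)" for w u v
      using G[of w u v] G[of w v u] B(2)[of u "G w v"] T(3)[of w u v] T(3)[of u w v] T(3)[of v w u]
      by (simp add: K_def field_simps)
  next
    fix H assume H: "bilinear H \<and> (\<forall>u v. H u v = H v u) \<and>
           (\<forall>w u v. T w u v = B (H w u) v + B u (H w v))"
    then have T_H: "T w u v = B (H w u) v + B u (H w v)" and sym: "H u v = H v u" for w u v by blast+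
    have "B (H w u) z = K w u z" for w u z
      using T_H[of w u z] T_H[of u w z] T_H[of z w u] B(2)[of u "H w z"] B(2)[of w "H u z"]
        B(2)[of w "H z u"] sym[of u w] sym[of z w] sym[of z u]
      by (simp add: K_def)
    then show "H = G" by (intro ext inj) (simp add: G)
  qed
qed

text \<open>
  Hence the definite descriptions above are well-defined where they are used.
\<close>

lemma weyl_connection_characterization:
  fixes g :: "'e::euclidean_space \<Rightarrow> 'e \<Rightarrow> 'e \<Rightarrow> real"
  assumes S: "open S" "x \<in> S"
    and g: "\<And>y. y \<in> S \<Longrightarrow> bilinear (g y)" "\<And>y u v. y \<in> S \<Longrightarrow> g y u v = g y v u"
      "\<And>v. v \<noteq> 0 \<Longrightarrow> g x v v > 0"
      "\<And>u v. (\<lambda>y. g y u v) differentiable (at x)"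
    and \<theta>: "linear (\<theta> x)"
  shows "bilinear G \<and> (\<forall>u v. G u v = G v u) \<and>
     (\<forall>w u v. cov_metric g x G w u v = - 2 * \<theta> x w * g x u v) \<longleftrightarrow> G = weyl_connection g \<theta> x"
proof -
  define T where "T w u v = frechet_derivative (\<lambda>y. g y u v) (at x) w + 2 * \<theta> x w * g x u v" for w u v
  have eq: "cov_metric g x G w u v = - 2 * \<theta> x w * g x u v \<longleftrightarrow>
      T w u v = g x (G w u) v + g x u (G w v)" for G w u v
    unfolding cov_metric_def T_def by linarith
  have cong: "frechet_derivative f (at x) = frechet_derivative h (at x)"
    if "\<And>y. y \<in> S \<Longrightarrow> f y = h y" "f differentiable (at x)" for f h :: "'e \<Rightarrow> real"
    by (rule frechet_derivative_transform_within_open[OF that(2) S that(1)])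
  have lin: "linear (\<lambda>u. g y u v)" if "y \<in> S" for y v
    using g(1)[OF that] by (simp add: bilinear_def)
  have D: "((\<lambda>y. g y u v) has_derivative frechet_derivative (\<lambda>y. g y u v) (at x)) (at x)" for u v
    using g(4) by (simp add: frechet_derivative_works[symmetric])
  have add: "frechet_derivative (\<lambda>y. g y (a + b) v) (at x) w =
      frechet_derivative (\<lambda>y. g y a v) (at x) w + frechet_derivative (\<lambda>y. g y b v) (at x) w" for a b v w
  proof -
    have "frechet_derivative (\<lambda>y. g y (a + b) v) (at x) = frechet_derivative (\<lambda>y. g y a v + g y b v) (at x)"
      by (rule cong) (simp_all add: linear_add[OF lin] g(4))
    also have "\<dots> = (\<lambda>w. frechet_derivative (\<lambda>y. g y a v) (at x) w + frechet_derivative (\<lambda>y. g y b v) (at x) w)"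
      by (rule frechet_derivative_at[symmetric]) (intro has_derivative_add D)
    finally show ?thesis by simp
  qed
  have scale: "frechet_derivative (\<lambda>y. g y (r *\<^sub>R a) v) (at x) w =
      r * frechet_derivative (\<lambda>y. g y a v) (at x) w" for r a v w
  proof -
    have "frechet_derivative (\<lambda>y. g y (r *\<^sub>R a) v) (at x) = frechet_derivative (\<lambda>y. r * g y a v) (at x)"
      by (rule cong) (simp_all add: linear_scale[OF lin] g(4))
    also have "\<dots> = (\<lambda>w. r * frechet_derivative (\<lambda>y. g y a v) (at x) w)"
      by (rule frechet_derivative_at[symmetric]) (intro has_derivative_mult_right D)
    finally show ?thesis by simp
  qed
  have "\<exists>!G. bilinear G \<and> (\<forall>u v. G u v = G v u) \<and>
      (\<forall>w u v. T w u v = g x (G w u) v + g x u (G w v))"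
  proof (rule ex1_christoffel)
    show "linear (\<lambda>w. T w u v)" for u v
      using linear_frechet_derivative[OF g(4)[of u v]] \<theta>
      by (intro linearI) (simp_all add: T_def linear_add linear_scale distrib_left distrib_right)
    show "linear (\<lambda>u. T w u v)" for w v
      by (rule linearI)
         (simp_all add: T_def add scale linear_add[OF lin[OF S(2)]] linear_scale[OF lin[OF S(2)]]
            algebra_simps)
    show "T w u v = T w v u" for w u v
    proof -
      have "frechet_derivative (\<lambda>y. g y u v) (at x) = frechet_derivative (\<lambda>y. g y v u) (at x)"
        by (rule cong) (rule g(2) g(4), assumption?)+
      then show ?thesis by (simp only: T_def g(2)[OF S(2), of u v])
    qed
    show "bilinear (g x)" by (rule g(1)[OF S(2)])
    show "g x u v = g x v u" for u v by (rule g(2)[OF S(2)])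
    show "g x v v > 0" if "v \<noteq> 0" for v by (rule g(3)[OF that])
  qed
  then have ex1: "\<exists>!G. bilinear G \<and> (\<forall>u v. G u v = G v u) \<and>
     (\<forall>w u v. cov_metric g x G w u v = - 2 * \<theta> x w * g x u v)"
    by (simp only: eq)
  show ?thesis
    unfolding weyl_connection_def
    by (rule iffI, rule sym, erule the1_equality[OF ex1], erule ssubst, rule theI'[OF ex1])
qed

lemma levi_civita_eq_weyl_connection: "levi_civita g = weyl_connection g (\<lambda>x v. 0)"
  by (simp add: fun_eq_iff levi_civita_def weyl_connection_def)

definition curvature ::
    "('e::euclidean_space \<Rightarrow> 'e \<Rightarrow> 'e \<Rightarrow> 'e) \<Rightarrow> 'e \<Rightarrow> 'e \<Rightarrow> 'e \<Rightarrow> 'e \<Rightarrow> 'e" where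
  "curvature \<Gamma> x u v w =
     frechet_derivative (\<lambda>y. \<Gamma> y v w) (at x) u - frechet_derivative (\<lambda>y. \<Gamma> y u w) (at x) v
     + \<Gamma> x u (\<Gamma> x v w) - \<Gamma> x v (\<Gamma> x u w)"

text \<open>The trace of \<open>z \<mapsto> R(z, u) v\<close>; it is independent of the basis used to compute it.\<close>

definition ricci ::
    "('e::euclidean_space \<Rightarrow> 'e \<Rightarrow> 'e \<Rightarrow> 'e) \<Rightarrow> 'e \<Rightarrow> 'e \<Rightarrow> 'e \<Rightarrow> real" where
  "ricci \<Gamma> x u v = (\<Sum>b\<in>Basis. curvature \<Gamma> x b u v \<bullet> b)"


subsection \<open>Sasakian, eta-Einstein and Einstein-Weyl structures\<close>

definition ext_deriv :: "('e::euclidean_space \<Rightarrow> 'e \<Rightarrow> real) \<Rightarrow> 'e \<Rightarrow> 'e \<Rightarrow> 'e \<Rightarrow> real" where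
  "ext_deriv \<alpha> x u v =
     frechet_derivative (\<lambda>y. \<alpha> y v) (at x) u - frechet_derivative (\<lambda>y. \<alpha> y u) (at x) v"

text \<open>
  A positive constant multiple of \<open>\<eta> \<and> (d\<eta>)^n\<close>, evaluated on \<open>v 0, ..., v (2 * n)\<close>; only its
  non-vanishing matters.
\<close>

definition contact_volume ::
    "nat \<Rightarrow> ('e::euclidean_space \<Rightarrow> 'e \<Rightarrow> real) \<Rightarrow> 'e \<Rightarrow> (nat \<Rightarrow> 'e) \<Rightarrow> real" where
  "contact_volume n \<eta> x v = (\<Sum>p | p permutes {..2 * n}.
     of_int (sign p) * \<eta> x (v (p 0)) *
     (\<Prod>i<n. ext_deriv \<eta> x (v (p (2 * i + 1))) (v (p (2 * i + 2)))))"

definition contact_form ::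
    "('a, 'e::euclidean_space) chart set \<Rightarrow> nat \<Rightarrow> ('a, 'e) form1 \<Rightarrow> bool" where
  "contact_form A n \<eta> \<longleftrightarrow> one_form A \<eta> \<and>
     (\<forall>c\<in>A. \<forall>x\<in>coords c. \<exists>v. contact_volume n (\<eta> c) x v \<noteq> 0)"

text \<open>
  The last clause is \<open>(\<nabla>\<^sub>X \<Phi>) Y = g(X, Y) \<xi> - \<eta>(Y) X\<close>. It is the condition that the metric cone be
  Kaehler, and unlike the latter it depends neither on the normalisation of the exterior derivative
  nor on how \<open>\<Phi>\<close> is extended to a complex structure on the cone.
\<close>

definition sasakian ::
    "('a, 'e::euclidean_space) chart set \<Rightarrow> nat \<Rightarrow>
     ('a, 'e) vfield \<Rightarrow> ('a, 'e) form1 \<Rightarrow> ('a, 'e) endofield \<Rightarrow> ('a, 'e) bilfield \<Rightarrow> bool" where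
  "sasakian A n \<xi> \<eta> \<Phi> g \<longleftrightarrow>
     DIM('e) = 2 * n + 1 \<and>
     vector_field A \<xi> \<and> contact_form A n \<eta> \<and> endo_field A \<Phi> \<and> riemannian_metric A g \<and>
     (\<forall>c\<in>A. \<forall>x\<in>coords c.
        \<eta> c x (\<xi> c x) = 1 \<and>
        (\<forall>v. \<Phi> c x (\<Phi> c x v) = - v + \<eta> c x v *\<^sub>R \<xi> c x) \<and>
        (\<forall>u v. g c x (\<Phi> c x u) (\<Phi> c x v) = g c x u v - \<eta> c x u * \<eta> c x v) \<and>
        (\<forall>u v. cov_endo (\<Phi> c) x (levi_civita (g c) x) u v =
                 g c x u v *\<^sub>R \<xi> c x - \<eta> c x v *\<^sub>R u))"

definition eta_einstein ::
    "('a, 'e::euclidean_space) chart set \<Rightarrow> ('a, 'e) form1 \<Rightarrow> ('a, 'e) bilfield \<Rightarrow>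
     real \<Rightarrow> real \<Rightarrow> bool" where
  "eta_einstein A \<eta> g l \<nu> \<longleftrightarrow> (\<forall>c\<in>A. \<forall>x\<in>coords c. \<forall>u v.
     ricci (levi_civita (g c)) x u v = l * g c x u v + \<nu> * \<eta> c x u * \<eta> c x v)"

definition einstein_weyl ::
    "('a, 'e::euclidean_space) chart set \<Rightarrow> ('a, 'e) bilfield \<Rightarrow> ('a, 'e) form1 \<Rightarrow> bool" where
  "einstein_weyl A g \<theta> \<longleftrightarrow> riemannian_metric A g \<and> one_form A \<theta> \<and>
     (\<exists>\<Lambda>. smooth_function A \<Lambda> \<and> (\<forall>c\<in>A. \<forall>x\<in>coords c. \<forall>u v.
        ricci (weyl_connection (g c) (\<theta> c)) x u v + ricci (weyl_connection (g c) (\<theta> c)) x v u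
          = \<Lambda> (param c x) * g c x u v))"

end

theory Submission
  imports Defs
begin

text \<open>
  Adding and subtracting the Einstein-Weyl equations of \<open>\<theta>\<close> and \<open>-\<theta>\<close> gives
  \<open>Ric = f g - (2n - 1) \<theta> \<otimes> \<theta>\<close> and shows that the symmetric part of \<open>\<nabla>\<theta>\<close> is \<open>h g\<close> for some function \<open>h\<close>.
  On a Sasakian manifold \<open>Ric(v, \<Phi> v) = 0\<close>, hence \<open>\<theta>(v) \<theta>(\<Phi> v) = 0\<close> for all \<open>v\<close>; applied to
  \<open>v + \<Phi> v\<close> this forces \<open>\<theta>\<close> to vanish on \<open>ker \<eta>\<close>, so \<open>\<theta> = a \<eta>\<close> with \<open>a = \<theta>(\<xi>)\<close>. As \<open>\<xi>\<close> is Killing, the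
  symmetric part of \<open>\<nabla>(a \<eta>)\<close> is that of \<open>da \<otimes> \<eta>\<close>, which can be a multiple of \<open>g\<close> only if \<open>da = 0\<close>.
  So \<open>a\<close> is constant and \<open>\<nu> = -(2n - 1) a\<^sup>2\<close>. Conversely, \<open>\<theta> = a \<eta>\<close> with \<open>a\<close> determined by this
  equation works.
\<close>

subsection \<open>Differentiation\<close>

text \<open>In the Ricci tensor of D the terms quadratic in \<theta> are even and the terms in
  \<nabla>\<theta> odd under \<theta> \<mapsto> -\<theta>; this is why sum and difference of the two
  equations separate them. The factor 2n - 1 is the dimension minus 2, and it has to be nonzero for
  Ric to determine \<theta> \<otimes> \<theta>. Strictness of \<nu> < 0 comes from \<theta> not
  vanishing identically, since \<theta> = 0 would give \<nu> = 0. The analytic obstacle is that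
  connections are given by definite descriptions and the dual field of \<theta> by choice, so their
  definitions say nothing about differentiability, while curvature differentiates them. Both solve
  linear systems whose coefficients are those of the metric, and differentiability is transferred
  from the data to the solution. The identity da = 0 is obtained chart by chart. Since a =
  \<theta>(\<xi>) is a scalar, the transformation laws make it a function on the manifold, where
  connectedness applies.\<close>

abbreviation dd :: "('e::euclidean_space \<Rightarrow> 'f::real_normed_vector) \<Rightarrow> 'e \<Rightarrow> 'e \<Rightarrow> 'f" where
  "dd f x \<equiv> frechet_derivative f (at x)"

lemma dd_works: "f differentiable (at x) \<Longrightarrow> (f has_derivative dd f x) (at x)"
  by (simp add: frechet_derivative_works[symmetric])

lemma ddI:
  assumes "(f has_derivative f') (at x)"
  shows "f differentiable (at x)" "dd f x = f'"
  using assms by (blast intro: differentiableI, metis frechet_derivative_at)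

text \<open>Components are meaningful only on the open set \<open>S\<close>, so identities between
  them hold only there; this is what allows them to be differentiated nevertheless.\<close>

lemma dd_cong:
  assumes "open S" "x \<in> S" "\<And>y. y \<in> S \<Longrightarrow> f y = h y" "f differentiable (at x)"
  shows "dd h x = dd f x" "h differentiable (at x)"
proof -
  have "(h has_derivative dd f x) (at x)"
    using has_derivative_transform_within_open[OF dd_works[OF assms(4)] assms(1,2,3)] .
  then show "dd h x = dd f x" "h differentiable (at x)" by (rule ddI)+
qed

lemma
  assumes "f differentiable (at x)" "h differentiable (at x)"
  shows dd_add: "dd (\<lambda>y. f y + h y) x w = dd f x w + dd h x w"
    and dd_diff: "dd (\<lambda>y. f y - h y) x w = dd f x w - dd h x w"
  using ddI(2)[OF has_derivative_add[OF assms[THEN dd_works]]]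
    ddI(2)[OF has_derivative_diff[OF assms[THEN dd_works]]] by simp_all

lemma dd_scaleR:
  assumes "f differentiable (at x)" "h differentiable (at x)"
  shows "dd (\<lambda>y. f y *\<^sub>R h y) x w = dd f x w *\<^sub>R h x + f x *\<^sub>R dd h x w"
  using ddI(2)[OF has_derivative_scaleR[OF assms[THEN dd_works]]] by simp

lemma dd_mult:
  fixes f h :: "'e::euclidean_space \<Rightarrow> real"
  assumes "f differentiable (at x)" "h differentiable (at x)"
  shows "dd (\<lambda>y. f y * h y) x w = dd f x w * h x + f x * dd h x w"
  using dd_scaleR[OF assms] by simp

lemma dd_minus:
  assumes "f differentiable (at x)"
  shows "dd (\<lambda>y. - f y) x w = - dd f x w"
  using ddI(2)[OF has_derivative_minus[OF dd_works[OF assms]]] by simp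

lemma linear_dd: "f differentiable (at x) \<Longrightarrow> linear (dd f x)"
  by (rule linear_frechet_derivative)

lemma linear_basis_expand:
  fixes L :: "'e::euclidean_space \<Rightarrow> 'f::real_vector"
  assumes "linear L" shows "L v = (\<Sum>b\<in>Basis. (v \<bullet> b) *\<^sub>R L b)"
proof -
  have "L v = L (\<Sum>b\<in>Basis. (v \<bullet> b) *\<^sub>R b)" by (simp add: euclidean_representation)
  then show ?thesis by (simp add: linear_sum[OF assms] linear_scale[OF assms])
qed

text \<open>Leibniz rule for a field of linear maps evaluated on a varying vector. Expanding
  \<open>F y\<close> in the basis turns the composite into a finite sum of products, so it is enough
  that \<open>L y u\<close> is differentiable in \<open>y\<close> for each fixed
  \<open>u\<close>.\<close>

lemma dd_linear_family:
  fixes L :: "'e::euclidean_space \<Rightarrow> 'h::euclidean_space \<Rightarrow> 'f::real_normed_vector"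
  assumes S: "open S" "x \<in> S" and L: "\<And>y. y \<in> S \<Longrightarrow> linear (L y)"
    and dL: "\<And>u. (\<lambda>y. L y u) differentiable (at x)" and F: "F differentiable (at x)"
  shows "(\<lambda>y. L y (F y)) differentiable (at x)"
    and "dd (\<lambda>y. L y (F y)) x w = dd (\<lambda>y. L y (F x)) x w + L x (dd F x w)"
proof -
  note D = dd_works[OF dL] dd_works[OF F]
  have "((\<lambda>y. \<Sum>b\<in>Basis. (F y \<bullet> b) *\<^sub>R L y b) has_derivative
      (\<lambda>w. \<Sum>b\<in>Basis. (F x \<bullet> b) *\<^sub>R dd (\<lambda>y. L y b) x w + (dd F x w \<bullet> b) *\<^sub>R L x b)) (at x)"
    by (auto intro!: derivative_eq_intros D)
  then have A: "((\<lambda>y. L y (F y)) has_derivative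
      (\<lambda>w. \<Sum>b\<in>Basis. (F x \<bullet> b) *\<^sub>R dd (\<lambda>y. L y b) x w + (dd F x w \<bullet> b) *\<^sub>R L x b)) (at x)"
    by (rule has_derivative_transform_within_open[OF _ S]) (metis L linear_basis_expand)
  have "((\<lambda>y. \<Sum>b\<in>Basis. (F x \<bullet> b) *\<^sub>R L y b) has_derivative
      (\<lambda>w. \<Sum>b\<in>Basis. (F x \<bullet> b) *\<^sub>R dd (\<lambda>y. L y b) x w)) (at x)"
    by (auto intro!: derivative_eq_intros D)
  then have B: "((\<lambda>y. L y (F x)) has_derivative
      (\<lambda>w. \<Sum>b\<in>Basis. (F x \<bullet> b) *\<^sub>R dd (\<lambda>y. L y b) x w)) (at x)"
    by (rule has_derivative_transform_within_open[OF _ S]) (metis L linear_basis_expand)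
  show "(\<lambda>y. L y (F y)) differentiable (at x)" using A by (rule ddI)
  show "dd (\<lambda>y. L y (F y)) x w = dd (\<lambda>y. L y (F x)) x w + L x (dd F x w)"
    using linear_basis_expand[OF L[OF S(2)], of "dd F x w"]
    by (simp add: ddI(2)[OF A] ddI(2)[OF B] sum.distrib)
qed

lemma linear_dd_family:
  fixes L :: "'e::euclidean_space \<Rightarrow> 'h::real_vector \<Rightarrow> 'f::real_normed_vector"
  assumes S: "open S" "x \<in> S" and L: "\<And>y. y \<in> S \<Longrightarrow> linear (L y)"
    and dL: "\<And>u. (\<lambda>y. L y u) differentiable (at x)"
  shows "linear (\<lambda>u. dd (\<lambda>y. L y u) x w)"
proof (rule linearI)
  fix a b r
  have "dd (\<lambda>y. L y (a + b)) x w = dd (\<lambda>y. L y a + L y b) x w"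
    by (rule fun_cong[OF dd_cong(1)[OF S]]) (auto simp: linear_add[OF L] intro!: differentiable_add dL)
  then show "dd (\<lambda>y. L y (a + b)) x w = dd (\<lambda>y. L y a) x w + dd (\<lambda>y. L y b) x w"
    by (simp add: dd_add dL)
  have "dd (\<lambda>y. L y (r *\<^sub>R a)) x w = dd (\<lambda>y. r *\<^sub>R L y a) x w"
    by (rule fun_cong[OF dd_cong(1)[OF S]]) (auto simp: linear_scale[OF L] intro!: differentiable_scaleR dL)
  then show "dd (\<lambda>y. L y (r *\<^sub>R a)) x w = r *\<^sub>R dd (\<lambda>y. L y a) x w"
    by (simp add: dd_scaleR dL)
qed

text \<open>The codomain is left general because the notion serves both the metric (real values) and
  the Christoffel symbols (vector values).\<close>

definition bilinear_family ::
    "'e::euclidean_space set \<Rightarrow> 'e \<Rightarrow> ('e \<Rightarrow> 'e \<Rightarrow> 'e \<Rightarrow> 'f::real_normed_vector) \<Rightarrow> bool" where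
  "bilinear_family S x B \<longleftrightarrow> open S \<and> x \<in> S \<and> (\<forall>y\<in>S. bilinear (B y)) \<and>
     (\<forall>u v. (\<lambda>y. B y u v) differentiable (at x))"

lemma bilinearD:
  assumes "bilinear B"
  shows "linear (B u)" "linear (\<lambda>u. B u v)"
  using assms by (auto simp: bilinear_def)

lemma dd_bilinear_family:
  fixes B :: "'e::euclidean_space \<Rightarrow> 'e \<Rightarrow> 'e \<Rightarrow> 'f::real_normed_vector"
  assumes B: "bilinear_family S x B" and F: "F differentiable (at x)" and H: "H differentiable (at x)"
  shows "(\<lambda>y. B y (F y) (H y)) differentiable (at x)"
    and "dd (\<lambda>y. B y (F y) (H y)) x w =
      dd (\<lambda>y. B y (F x) (H x)) x w + B x (dd F x w) (H x) + B x (F x) (dd H x w)"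
proof -
  have S: "open S" "x \<in> S" and lin: "\<And>y u. y \<in> S \<Longrightarrow> linear (B y u)"
    "\<And>y v. y \<in> S \<Longrightarrow> linear (\<lambda>u. B y u v)"
    and d: "\<And>u v. (\<lambda>y. B y u v) differentiable (at x)"
    using B by (auto simp: bilinear_family_def dest: bilinearD)
  have d1: "(\<lambda>y. B y u (H y)) differentiable (at x)"
    and e1: "dd (\<lambda>y. B y u (H y)) x w = dd (\<lambda>y. B y u (H x)) x w + B x u (dd H x w)" for u
    by (rule dd_linear_family[OF S lin(1) d H], assumption)+
  have lin': "\<And>y. y \<in> S \<Longrightarrow> linear (\<lambda>u. B y u (H y))" by (rule lin)
  show "(\<lambda>y. B y (F y) (H y)) differentiable (at x)"
    using dd_linear_family(1)[OF S lin' d1 F] .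
  show "dd (\<lambda>y. B y (F y) (H y)) x w =
      dd (\<lambda>y. B y (F x) (H x)) x w + B x (dd F x w) (H x) + B x (F x) (dd H x w)"
    using dd_linear_family(2)[OF S lin' d1 F, of w] by (simp add: e1)
qed

lemma linear_dd_bilinear_family:
  fixes B :: "'e::euclidean_space \<Rightarrow> 'e \<Rightarrow> 'e \<Rightarrow> 'f::real_normed_vector"
  assumes B: "bilinear_family S x B"
  shows "linear (\<lambda>w. dd (\<lambda>y. B y u v) x w)" "linear (\<lambda>u. dd (\<lambda>y. B y u v) x w)"
    "linear (\<lambda>v. dd (\<lambda>y. B y u v) x w)"
proof -
  have S: "open S" "x \<in> S" and lin: "\<And>y u. y \<in> S \<Longrightarrow> linear (B y u)"
    "\<And>y v. y \<in> S \<Longrightarrow> linear (\<lambda>u. B y u v)"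
    and d: "\<And>u v. (\<lambda>y. B y u v) differentiable (at x)"
    using B by (auto simp: bilinear_family_def dest: bilinearD)
  show "linear (\<lambda>w. dd (\<lambda>y. B y u v) x w)" by (rule linear_dd[OF d])
  show "linear (\<lambda>u. dd (\<lambda>y. B y u v) x w)" by (rule linear_dd_family[OF S lin(2) d])
  show "linear (\<lambda>v. dd (\<lambda>y. B y u v) x w)" by (rule linear_dd_family[OF S lin(1) d])
qed

section \<open>Symmetry of second derivatives\<close>

text \<open>The mean value theorem in direction \<open>u\<close> turns the second difference into a
  difference of \<open>dd f _ u\<close> at two points at distance O(t) from \<open>x\<close>, to
  which the first-order expansion of \<open>dd f _ u\<close> at \<open>x\<close> applies. The second
  difference is symmetric in \<open>u\<close> and \<open>v\<close>, its limit therefore as well;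
  continuity of second derivatives is not assumed.\<close>

lemma second_difference:
  fixes f :: "'e::euclidean_space \<Rightarrow> real"
  assumes S: "open S" "x \<in> S" and f: "\<And>y. y \<in> S \<Longrightarrow> f differentiable (at y)"
    and h: "((\<lambda>y. dd f y u) has_derivative H) (at x)" and e: "\<epsilon> > 0"
  shows "\<exists>\<delta>>0. \<forall>t. 0 < t \<and> t < \<delta> \<longrightarrow>
    \<bar>f (x + t *\<^sub>R u + t *\<^sub>R v) - f (x + t *\<^sub>R u) - f (x + t *\<^sub>R v) + f x - t * t * H v\<bar> \<le> \<epsilon> * (t * t)"
proof -
  \<comment> \<open>The displacements that occur have norm below \<open>t * K\<close>; the summand 1
    makes this strict and keeps \<open>K\<close> positive when \<open>u = v = 0\<close>.\<close>
  define K where "K = norm u + norm v + 1"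
  have K: "K > 0" by (simp add: K_def add_nonneg_pos)
  \<comment> \<open>Two expansion errors arise, each at most \<open>e' * (t * K)\<close>, which is
    half of \<open>\<epsilon> * t\<close>.\<close>
  define e' where "e' = \<epsilon> / (2 * K)"
  have e': "e' > 0" using e K by (simp add: e'_def)
  obtain d1 where d1: "d1 > 0" "\<And>y. norm (y - x) < d1 \<Longrightarrow>
      norm (dd f y u - dd f x u - H (y - x)) \<le> e' * norm (y - x)"
    using h e' unfolding has_derivative_at_alt by blast
  obtain d2 where d2: "d2 > 0" "ball x d2 \<subseteq> S" using S open_contains_ball by blast
  have bl: "bounded_linear H" using h by (rule has_derivative_bounded_linear)
  then have lin: "linear H" by (rule bounded_linear.linear)
  define \<delta> where "\<delta> = min d1 d2 / K"
  have "\<delta> > 0" using d1 d2 K by (simp add: \<delta>_def)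
  moreover have "\<bar>f (x + t *\<^sub>R u + t *\<^sub>R v) - f (x + t *\<^sub>R u) - f (x + t *\<^sub>R v) + f x - t * t * H v\<bar> \<le> \<epsilon> * (t * t)"
    if t: "0 < t" "t < \<delta>" for t
  proof -
    have tK: "t * K < min d1 d2" using t K by (simp add: \<delta>_def field_simps)
    have nrm: "norm (s *\<^sub>R (t *\<^sub>R u) + r *\<^sub>R (t *\<^sub>R v)) < t * K" if "0 \<le> s" "s \<le> 1" "0 \<le> r" "r \<le> 1" for s r
    proof -
      have "norm (s *\<^sub>R (t *\<^sub>R u) + r *\<^sub>R (t *\<^sub>R v)) \<le> s * (t * norm u) + r * (t * norm v)"
        using norm_triangle_ineq[of "s *\<^sub>R (t *\<^sub>R u)" "r *\<^sub>R (t *\<^sub>R v)"] that t by simp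
      also have "\<dots> \<le> t * norm u + t * norm v"
        using that t by (intro add_mono mult_left_le_one_le) auto
      also have "\<dots> < t * K" using t by (simp add: K_def algebra_simps)
      finally show ?thesis .
    qed
    have inS: "x + (s *\<^sub>R (t *\<^sub>R u) + r *\<^sub>R (t *\<^sub>R v)) \<in> S" if "0 \<le> s" "s \<le> 1" "0 \<le> r" "r \<le> 1" for s r
    proof -
      have "x + (s *\<^sub>R (t *\<^sub>R u) + r *\<^sub>R (t *\<^sub>R v)) \<in> ball x d2"
        using nrm[OF that] tK unfolding mem_ball dist_norm
        by (metis add_diff_cancel_left' min_less_iff_conj norm_minus_commute order_less_trans)
      then show ?thesis using d2(2) by blast
    qed
    define \<phi> where "\<phi> s = f (x + (s *\<^sub>R (t *\<^sub>R u) + t *\<^sub>R v)) - f (x + s *\<^sub>R (t *\<^sub>R u))" for s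
    define \<phi>' where "\<phi>' s = (\<lambda>r. r * (t * (dd f (x + (s *\<^sub>R (t *\<^sub>R u) + t *\<^sub>R v)) u
        - dd f (x + s *\<^sub>R (t *\<^sub>R u)) u)))" for s
    have der: "(\<phi> has_derivative \<phi>' s) (at s within {0..1})" if s: "0 \<le> s" "s \<le> 1" for s
    proof -
      have a: "(f has_derivative dd f (x + (s *\<^sub>R (t *\<^sub>R u) + t *\<^sub>R v))) (at (x + (s *\<^sub>R (t *\<^sub>R u) + t *\<^sub>R v)))"
        using f[OF inS[of s 1]] s by (simp add: dd_works)
      have b: "(f has_derivative dd f (x + s *\<^sub>R (t *\<^sub>R u))) (at (x + s *\<^sub>R (t *\<^sub>R u)))"
        using f[OF inS[of s 0]] s by (simp add: dd_works)
      have a': "((\<lambda>s. f (x + (s *\<^sub>R (t *\<^sub>R u) + t *\<^sub>R v))) has_derivative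
          (\<lambda>r. dd f (x + (s *\<^sub>R (t *\<^sub>R u) + t *\<^sub>R v)) (r *\<^sub>R (t *\<^sub>R u)))) (at s within {0..1})"
        by (rule has_derivative_compose[where f = "\<lambda>s. x + (s *\<^sub>R (t *\<^sub>R u) + t *\<^sub>R v)", OF _ a])
          (auto intro!: derivative_eq_intros)
      have b': "((\<lambda>s. f (x + s *\<^sub>R (t *\<^sub>R u))) has_derivative
          (\<lambda>r. dd f (x + s *\<^sub>R (t *\<^sub>R u)) (r *\<^sub>R (t *\<^sub>R u)))) (at s within {0..1})"
        by (rule has_derivative_compose[where f = "\<lambda>s. x + s *\<^sub>R (t *\<^sub>R u)", OF _ b])
          (auto intro!: derivative_eq_intros)
      have la: "linear (dd f (x + (s *\<^sub>R (t *\<^sub>R u) + t *\<^sub>R v)))"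
        and lb: "linear (dd f (x + s *\<^sub>R (t *\<^sub>R u)))"
        using a b has_derivative_linear by blast+
      show ?thesis
        using has_derivative_diff[OF a' b']
        unfolding \<phi>_def \<phi>'_def
        by (simp only: linear_scale[OF la] linear_scale[OF lb] real_scaleR_def right_diff_distrib)
    qed
    obtain s where s: "s \<in> {0<..<1}" "\<phi> 1 - \<phi> 0 = \<phi>' s (1 - 0)"
      using mvt_simple[of 0 1 \<phi> \<phi>'] der by fastforce
    define a where "a = s *\<^sub>R (t *\<^sub>R u) + t *\<^sub>R v"
    define b where "b = s *\<^sub>R (t *\<^sub>R u)"
    have na: "norm a < t * K" and nb: "norm b < t * K"
      using nrm[of s 1] nrm[of s 0] s by (auto simp: a_def b_def)
    have ra: "norm (dd f (x + a) u - dd f x u - H a) \<le> e' * (t * K)"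
    proof -
      have "norm (dd f (x + a) u - dd f x u - H a) \<le> e' * norm a"
        using d1(2)[of "x + a"] na tK by simp
      also have "\<dots> \<le> e' * (t * K)" using na e' by simp
      finally show ?thesis .
    qed
    have rb: "norm (dd f (x + b) u - dd f x u - H b) \<le> e' * (t * K)"
    proof -
      have "norm (dd f (x + b) u - dd f x u - H b) \<le> e' * norm b"
        using d1(2)[of "x + b"] nb tK by simp
      also have "\<dots> \<le> e' * (t * K)" using nb e' by simp
      finally show ?thesis .
    qed
    have "H a - H b = t * H v"
      by (simp add: a_def b_def linear_add[OF lin] linear_scale[OF lin])
    moreover have "e' * (t * K) = \<epsilon> * t / 2" using K by (simp add: e'_def field_simps)
    ultimately have *: "\<bar>dd f (x + a) u - dd f (x + b) u - t * H v\<bar> \<le> \<epsilon> * t"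
      using ra rb \<open>e' * (t * K) = \<epsilon> * t / 2\<close> unfolding real_norm_def by linarith
    have "\<phi> 1 - \<phi> 0 = t * (dd f (x + a) u - dd f (x + b) u)"
      using s(2) by (simp add: \<phi>'_def a_def b_def)
    moreover have "\<phi> 1 - \<phi> 0 = f (x + t *\<^sub>R u + t *\<^sub>R v) - f (x + t *\<^sub>R u) - f (x + t *\<^sub>R v) + f x"
      by (simp add: \<phi>_def add.assoc)
    ultimately have "\<bar>f (x + t *\<^sub>R u + t *\<^sub>R v) - f (x + t *\<^sub>R u) - f (x + t *\<^sub>R v) + f x - t * t * H v\<bar>
        = t * \<bar>dd f (x + a) u - dd f (x + b) u - t * H v\<bar>"
      using t(1) by (simp add: abs_mult_pos' algebra_simps)
    also have "\<dots> \<le> t * (\<epsilon> * t)" using * t(1) by (intro mult_left_mono) auto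
    finally show ?thesis by (simp add: algebra_simps)
  qed
  ultimately show ?thesis by blast
qed

lemma second_derivative_symmetric_real:
  fixes f :: "'e::euclidean_space \<Rightarrow> real"
  assumes S: "open S" "x \<in> S" and f: "\<And>y. y \<in> S \<Longrightarrow> f differentiable (at y)"
    and d: "\<And>u. (\<lambda>y. dd f y u) differentiable (at x)"
  shows "dd (\<lambda>y. dd f y u) x v = dd (\<lambda>y. dd f y v) x u"
proof (rule ccontr)
  assume ne: "\<not> ?thesis"
  \<comment> \<open>For small common \<open>t\<close>, both derivatives approximate the same second
    difference with error at most \<open>c / 3 * (t * t)\<close>, so their gap is at most
    \<open>2 * (c / 3)\<close>, less than \<open>c\<close>.\<close>
  define c where "c = \<bar>dd (\<lambda>y. dd f y u) x v - dd (\<lambda>y. dd f y v) x u\<bar>"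
  have c: "c / 3 > 0" using ne by (simp add: c_def)
  obtain d1 where d1: "d1 > 0" "\<And>t. 0 < t \<Longrightarrow> t < d1 \<Longrightarrow>
    \<bar>f (x + t *\<^sub>R u + t *\<^sub>R v) - f (x + t *\<^sub>R u) - f (x + t *\<^sub>R v) + f x - t * t * dd (\<lambda>y. dd f y u) x v\<bar> \<le> c / 3 * (t * t)"
    using second_difference[OF S f dd_works[OF d] c] by blast
  obtain d2 where d2: "d2 > 0" "\<And>t. 0 < t \<Longrightarrow> t < d2 \<Longrightarrow>
    \<bar>f (x + t *\<^sub>R v + t *\<^sub>R u) - f (x + t *\<^sub>R v) - f (x + t *\<^sub>R u) + f x - t * t * dd (\<lambda>y. dd f y v) x u\<bar> \<le> c / 3 * (t * t)"
    using second_difference[OF S f dd_works[OF d] c] by blast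
  define t where "t = min d1 d2 / 2"
  have t: "0 < t" "t < d1" "t < d2" using d1(1) d2(1) by (auto simp: t_def)
  have "\<bar>t * t * dd (\<lambda>y. dd f y u) x v - t * t * dd (\<lambda>y. dd f y v) x u\<bar> \<le> 2 * (c / 3 * (t * t))"
  proof -
    have "x + t *\<^sub>R v + t *\<^sub>R u = x + t *\<^sub>R u + t *\<^sub>R v" by simp
    then show ?thesis using d1(2)[OF t(1,2)] d2(2)[OF t(1,3)] by (simp only: abs_le_iff) linarith
  qed
  moreover have "\<bar>t * t * dd (\<lambda>y. dd f y u) x v - t * t * dd (\<lambda>y. dd f y v) x u\<bar> = (t * t) * c"
    by (simp add: c_def abs_mult flip: right_diff_distrib)
  ultimately have "(t * t) * c \<le> (t * t) * (2 * (c / 3))" by (simp add: mult.commute)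
  then have "c \<le> 2 * (c / 3)" using t(1) by (subst (asm) mult_le_cancel_left_pos) auto
  then show False using c by simp
qed

lemma second_derivative_symmetric:
  fixes f :: "'e::euclidean_space \<Rightarrow> 'f::euclidean_space"
  assumes S: "open S" "x \<in> S" and f: "\<And>y. y \<in> S \<Longrightarrow> f differentiable (at y)"
    and d: "\<And>u. (\<lambda>y. dd f y u) differentiable (at x)"
  shows "dd (\<lambda>y. dd f y u) x v = dd (\<lambda>y. dd f y v) x u"
proof (rule euclidean_eqI)
  fix b :: 'f
  have ip: "((\<lambda>y. h y \<bullet> b) has_derivative (\<lambda>w. dd h z w \<bullet> b)) (at z)"
    if "h differentiable (at z)" for z and h :: "'e \<Rightarrow> 'f"
    using dd_works[OF that] by (rule has_derivative_inner_left)
  have e: "dd (\<lambda>y. f y \<bullet> b) y w = dd f y w \<bullet> b" if "y \<in> S" for y w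
    using ddI(2)[OF ip[OF f[OF that]]] by simp
  have e2: "dd (\<lambda>y. dd (\<lambda>y. f y \<bullet> b) y w) x z = dd (\<lambda>y. dd f y w) x z \<bullet> b"
    and d2: "(\<lambda>y. dd (\<lambda>y. f y \<bullet> b) y w) differentiable (at x)" for w z
    using dd_cong[OF S, of "\<lambda>y. dd f y w \<bullet> b" "\<lambda>y. dd (\<lambda>y. f y \<bullet> b) y w"] e ddI[OF ip[OF d]]
    by auto
  show "dd (\<lambda>y. dd f y u) x v \<bullet> b = dd (\<lambda>y. dd f y v) x u \<bullet> b"
    using second_derivative_symmetric_real[OF S, of "\<lambda>y. f y \<bullet> b" u v] ddI(1)[OF ip[OF f]] d2
    by (simp add: e2)
qed

section \<open>Differentiability of solutions of linear systems\<close>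

text \<open>Nothing is assumed about \<open>h\<close> beyond the equation, not even continuity.
  Writing \<open>L = id + E\<close> with \<open>E\<close> small near \<open>x\<close>, the equation
  reads \<open>h = k - E h\<close>: smallness of \<open>E\<close> first bounds
  \<open>h y - h x\<close> by a multiple of \<open>norm (y - x)\<close> and then shows that
  \<open>h\<close> agrees to first order with a differentiable function.\<close>

lemma differentiable_solution_near_identity:
  fixes L :: "'e::euclidean_space \<Rightarrow> 'h::euclidean_space \<Rightarrow> 'h"
  assumes S: "open S" "x \<in> S" and L: "\<And>y. y \<in> S \<Longrightarrow> linear (L y)"
    and dL: "\<And>u. (\<lambda>y. L y u) differentiable (at x)" and id: "\<And>v. L x v = v"
    and k: "k differentiable (at x)" and eq: "\<And>y. y \<in> S \<Longrightarrow> L y (h y) = k y"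
  shows "h differentiable (at x)"
proof -
  define E where "E y v = L y v - v" for y v
  \<comment> \<open>One iteration step for \<open>h = k - E h\<close>, with the unknown frozen at
    its value in \<open>x\<close>; \<open>p\<close> turns out to have the same derivative as
    \<open>h\<close>.\<close>
  define p where "p y = k y - E y (h x)" for y
  have linE: "linear (E y)" if "y \<in> S" for y
    unfolding E_def using L[OF that] by (intro linear_compose_sub linear_ident)
  have dE: "(\<lambda>y. E y v) differentiable (at x)" for v
    unfolding E_def by (intro differentiable_diff dL) simp
  have "p differentiable (at x)" unfolding p_def by (intro differentiable_diff k dE)
  then have p: "(p has_derivative dd p x) (at x)" by (rule dd_works)
  have pder: "bounded_linear (dd p x)" using p by (rule has_derivative_bounded_linear)
  then obtain K where K: "K > 0" "\<And>w. norm (dd p x w) \<le> norm w * K"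
    using bounded_linear.pos_bounded by blast
  define m where "m y = (\<Sum>b\<in>Basis. norm (E y b))" for y
  have m0: "m x = 0" by (simp add: m_def E_def id)
  have mcont: "isCont m x"
    unfolding m_def by (intro continuous_intros differentiable_imp_continuous_within dE)
  have mb: "norm (E y v) \<le> m y * norm v" if "y \<in> S" for y v
  proof -
    have "norm (E y v) = norm (\<Sum>b\<in>Basis. (v \<bullet> b) *\<^sub>R E y b)"
      using linear_basis_expand[OF linE[OF that]] by metis
    also have "\<dots> \<le> (\<Sum>b\<in>Basis. norm ((v \<bullet> b) *\<^sub>R E y b))" by (rule norm_sum)
    also have "\<dots> \<le> (\<Sum>b\<in>Basis. norm (E y b) * norm v)"
      by (intro sum_mono) (simp add: Basis_le_norm mult.commute[of _ "norm v"] mult_right_mono)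
    finally show ?thesis by (simp add: m_def sum_distrib_right)
  qed
  have diff: "h y - p y = - E y (h y - h x)" if "y \<in> S" for y
    using eq[OF that] by (simp add: p_def linear_diff[OF linE[OF that]]) (simp add: E_def)
  have px: "p x = h x" using eq[OF S(2)] by (simp add: p_def E_def id)
  have "((\<lambda>y. h y - p y) has_derivative (\<lambda>w. 0)) (at x)"
    unfolding has_derivative_at_alt
  proof (intro conjI allI impI)
    fix e :: real assume e: "e > 0"
    obtain d1 where d1: "d1 > 0" "\<And>y. norm (y - x) < d1 \<Longrightarrow> norm (p y - p x - dd p x (y - x)) \<le> 1 * norm (y - x)"
      using p unfolding has_derivative_at_alt by (meson zero_less_one)
    \<comment> \<open>The bound 1/2 lets \<open>m y * norm (h y - h x)\<close> be absorbed on the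
      left, giving the Lipschitz constant \<open>2 * (1 + K)\<close> at \<open>x\<close>; the other
      bound then yields the error \<open>e * norm (y - x)\<close>.\<close>
    define e' where "e' = min (1/2) (e / (2 * (1 + K)))"
    have e': "e' > 0" using e K by (simp add: e'_def)
    obtain d2 where d2: "d2 > 0" "\<And>y. norm (y - x) < d2 \<Longrightarrow> \<bar>m y\<bar> < e'"
      using mcont e' m0 unfolding continuous_at_eps_delta by (auto simp: dist_norm)
    obtain d3 where d3: "d3 > 0" "ball x d3 \<subseteq> S" using S open_contains_ball by blast
    have "norm (h y - p y - (h x - p x) - 0) \<le> e * norm (y - x)"
      if y: "norm (y - x) < min d1 (min d2 d3)" for y
    proof -
      have yS: "y \<in> S" using y d3 by (auto simp: subset_iff dist_norm norm_minus_commute)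
      have m1: "m y < 1/2" and m2: "m y < e / (2 * (1 + K))" using d2(2)[of y] y by (auto simp: e'_def)
      have m3: "m y \<ge> 0" by (simp add: m_def sum_nonneg)
      have q: "norm (h y - p y) \<le> m y * norm (h y - h x)"
        using mb[OF yS, of "h y - h x"] diff[OF yS] by simp
      have pp: "norm (p y - p x) \<le> (1 + K) * norm (y - x)"
        using d1(2)[of y] K(2)[of "y - x"] y norm_triangle_sub[of "p y - p x" "dd p x (y - x)"]
        by (simp add: algebra_simps)
      have "norm (h y - h x) \<le> norm (h y - p y) + norm (p y - p x)"
        using norm_triangle_ineq[of "h y - p y" "p y - p x"] by (simp add: px)
      also have "\<dots> \<le> 1/2 * norm (h y - h x) + (1 + K) * norm (y - x)"
        using q pp m1 mult_right_mono[of "m y" "1/2" "norm (h y - h x)"] by simp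
      finally have "norm (h y - h x) \<le> 2 * ((1 + K) * norm (y - x))" by simp
      then have "m y * norm (h y - h x) \<le> e / (2 * (1 + K)) * (2 * ((1 + K) * norm (y - x)))"
        using m2 m3 by (intro mult_mono) auto
      also have "\<dots> = e * norm (y - x)" using K by (simp add: divide_simps)
      finally show ?thesis using q by (simp add: px)
    qed
    then show "\<exists>d>0. \<forall>y. norm (y - x) < d \<longrightarrow> norm (h y - p y - (h x - p x) - 0) \<le> e * norm (y - x)"
      using d1(1) d2(1) d3(1) by (intro exI[of _ "min d1 (min d2 d3)"]) auto
  qed simp
  from has_derivative_add[OF this p] show ?thesis by (simp add: ddI(1))
qed

text \<open>Composition with a left inverse of the fixed map \<open>L x\<close> reduces to the case
  where \<open>L x\<close> is the identity.\<close>

lemma differentiable_solution: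
  fixes L :: "'e::euclidean_space \<Rightarrow> 'h::euclidean_space \<Rightarrow> 'h"
  assumes S: "open S" "x \<in> S" and L: "\<And>y. y \<in> S \<Longrightarrow> linear (L y)"
    and dL: "\<And>u. (\<lambda>y. L y u) differentiable (at x)" and inj: "inj (L x)"
    and k: "k differentiable (at x)" and eq: "\<And>y. y \<in> S \<Longrightarrow> L y (h y) = k y"
  shows "h differentiable (at x)"
proof -
  obtain M where M: "linear M" "\<And>v. M (L x v) = v"
    using linear_injective_left_inverse[OF L[OF S(2)] inj] by (auto simp: fun_eq_iff)
  have dM: "(\<lambda>y. M (f y)) differentiable (at x)" if "f differentiable (at x)" for f
    using differentiable_compose[of M f x UNIV] that linear_imp_differentiable[OF M(1)] by blast
  show ?thesis
  proof (rule differentiable_solution_near_identity[OF S, of "\<lambda>y v. M (L y v)" "\<lambda>y. M (k y)"])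
    show "linear (\<lambda>v. M (L y v))" if "y \<in> S" for y
      using linear_compose[OF L[OF that] M(1)] by (simp add: o_def)
  qed (auto simp: M eq intro!: dM dL k)
qed

section \<open>Smooth functions\<close>

lemma smooth_on_differentiable: "smooth_on f S \<Longrightarrow> x \<in> S \<Longrightarrow> f differentiable (at x)"
  unfolding smooth_on_def by (metis Ck_on.simps(2))

lemma smooth_on_dd: "smooth_on f S \<Longrightarrow> smooth_on (\<lambda>x. dd f x v) S"
  unfolding smooth_on_def by (metis Ck_on.simps(2))

lemma Ck_on_cong:
  assumes "open S" "\<And>x. x \<in> S \<Longrightarrow> f x = h x" "Ck_on k f S"
  shows "Ck_on k h S"
  using assms(2,3)
proof (induction k arbitrary: f h)
  case 0
  then show ?case using continuous_on_eq by (metis Ck_on.simps(1))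
next
  case (Suc k)
  have d: "\<And>x. x \<in> S \<Longrightarrow> f differentiable (at x)" using Suc.prems by simp
  note c = dd_cong[OF assms(1) _ Suc.prems(1) d]
  show ?case
    using Suc.prems(2) c(2) Suc.IH[of "\<lambda>x. dd f x v" "\<lambda>x. dd h x v" for v] by (auto simp: c(1))
qed

lemma smooth_on_scale:
  fixes f :: "'e::euclidean_space \<Rightarrow> real"
  assumes S: "open S" and "smooth_on f S" shows "smooth_on (\<lambda>x. c * f x) S"
proof -
  have "Ck_on k f S \<Longrightarrow> Ck_on k (\<lambda>x. c * f x) S" for k
  proof (induction k arbitrary: f)
    case 0
    then show ?case by (auto intro: continuous_intros)
  next
    case (Suc k)
    have e: "c * dd f x v = dd (\<lambda>x. c * f x) x v" if "x \<in> S" for x v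
      using Suc.prems that by (simp add: dd_mult)
    have "Ck_on k (\<lambda>x. dd (\<lambda>x. c * f x) x v) S" for v
      by (rule Ck_on_cong[OF S e Suc.IH]) (use Suc.prems in auto)
    then show ?case using Suc.prems by (auto intro!: differentiable_mult)
  qed
  then show ?thesis using assms(2) by (simp add: smooth_on_def)
qed

lemma smooth_on_const: "smooth_on (\<lambda>x. c) S"
proof -
  have "Ck_on k (\<lambda>x. c) S" for k
    by (induction k arbitrary: c) (simp_all add: frechet_derivative_const)
  then show ?thesis by (simp add: smooth_on_def)
qed

subsection \<open>Traces\<close>

definition tr :: "('e::euclidean_space \<Rightarrow> 'e) \<Rightarrow> real" where
  "tr L = (\<Sum>b\<in>Basis. L b \<bullet> b)"

lemma tr_add: "tr (\<lambda>u. A u + B u) = tr A + tr B"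
  and tr_diff: "tr (\<lambda>u. A u - B u) = tr A - tr B"
  and tr_minus: "tr (\<lambda>u. - A u) = - tr A"
  and tr_scale: "tr (\<lambda>u. c *\<^sub>R A u) = c * tr A"
  by (simp_all add: tr_def inner_add_left inner_diff_left sum.distrib sum_subtractf sum_negf sum_distrib_left)

lemma tr_id: "tr (\<lambda>u::'e::euclidean_space. u) = DIM('e)"
  by (simp add: tr_def inner_Basis)

text \<open>The basic contraction: every trace of a term that is not a multiple of the identity or
  of a named operator reduces to it in the Ricci computations.\<close>

lemma tr_rank_one:
  fixes f :: "'e::euclidean_space \<Rightarrow> real"
  assumes "linear f" shows "tr (\<lambda>u. f u *\<^sub>R a) = f a"
  using linear_basis_expand[OF assms, of a] by (simp add: tr_def mult.commute)

lemma tr_commute: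
  fixes A B :: "'e::euclidean_space \<Rightarrow> 'e"
  assumes "linear A" "linear B" shows "tr (\<lambda>u. A (B u)) = tr (\<lambda>u. B (A u))"
proof -
  have *: "tr (\<lambda>u. A (B u)) = (\<Sum>b\<in>Basis. \<Sum>c\<in>Basis. (B b \<bullet> c) * (A c \<bullet> b))"
    if "linear A" for A B :: "'e \<Rightarrow> 'e"
    unfolding tr_def by (subst linear_basis_expand[OF that]) (simp add: inner_sum_left)
  show ?thesis
    by (subst (1 2) *, rule assms, rule assms, subst sum.swap) (simp add: mult.commute)
qed

text \<open>The basis that computes the trace is orthonormal for the inner product and not for
  \<open>B\<close>. Conjugation with the Gram operator \<open>G\<close> of \<open>B\<close>
  preserves the trace and converts skewness for \<open>B\<close> into a statement about inner
  products.\<close>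

lemma tr_skew_adjoint:
  fixes B :: "'e::euclidean_space \<Rightarrow> 'e \<Rightarrow> real"
  assumes B: "bilinear B" "\<And>u v. B u v = B v u" "\<And>v. v \<noteq> 0 \<Longrightarrow> B v v > 0"
    and L: "linear L" "linear L'" and skew: "\<And>u v. B (L u) v = - B u (L' v)"
  shows "tr L = - tr L'"
proof -
  define G where "G u = (\<Sum>b\<in>Basis. B u b *\<^sub>R b)" for u
  have lG: "linear G"
    unfolding G_def
    by (intro linearI) (simp_all add: linear_add[OF bilinearD(2)[OF B(1)]]
        linear_scale[OF bilinearD(2)[OF B(1)]] algebra_simps sum.distrib scaleR_sum_right)
  have G: "G u \<bullet> v = B u v" for u v
    using linear_basis_expand[OF bilinearD(1)[OF B(1)], of u v]
    by (simp add: G_def inner_sum_left inner_commute[of v] mult.commute)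
  have "inj G"
    unfolding linear_injective_0[OF lG] using G B(3) by (metis inner_zero_left less_irrefl)
  then obtain I where I: "linear I" "\<And>v. G (I v) = v" "\<And>v. I (G v) = v"
    using linear_injective_isomorphism[OF lG] by blast
  have "tr L = tr (\<lambda>u. I (G (L u)))" by (simp add: I)
  also have "\<dots> = tr (\<lambda>u. G (L (I u)))"
    using tr_commute[OF I(1) linear_compose[OF L(1) lG]] by (simp add: o_def)
  also have "\<dots> = - tr L'"
    by (simp add: tr_def G skew sum_negf) (simp add: G[symmetric] I inner_commute)
  finally show ?thesis .
qed

subsection \<open>Levi-Civita and Weyl connections\<close>

lemma curvature_linear:
  assumes "bilinear_family S x \<Gamma>"
  shows "linear (\<lambda>u. curvature \<Gamma> x u v w)" "linear (\<lambda>w. curvature \<Gamma> x u v w)"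
proof -
  note d = linear_dd_bilinear_family[OF assms]
  have "bilinear (\<Gamma> x)" using assms by (simp add: bilinear_family_def)
  note b = bilinearD[OF this]
  show "linear (\<lambda>u. curvature \<Gamma> x u v w)" "linear (\<lambda>w. curvature \<Gamma> x u v w)"
    unfolding curvature_def
    by (auto intro!: linearI simp: linear_add[OF d(1)] linear_add[OF d(2)] linear_add[OF d(3)]
      linear_scale[OF d(1)] linear_scale[OF d(2)] linear_scale[OF d(3)]
      linear_add[OF b(1)] linear_add[OF b(2)] linear_scale[OF b(1)] linear_scale[OF b(2)] algebra_simps)
qed

lemma ricci_eq_tr: "ricci \<Gamma> x u v = tr (\<lambda>z. curvature \<Gamma> x z u v)"
  by (simp add: ricci_def tr_def)

locale metric_chart =
  fixes S :: "'e::euclidean_space set" and g :: "'e \<Rightarrow> 'e \<Rightarrow> 'e \<Rightarrow> real"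
  assumes open_S: "open S"
    and bil: "y \<in> S \<Longrightarrow> bilinear (g y)"
    and g_sym: "y \<in> S \<Longrightarrow> g y u v = g y v u"
    and pos: "y \<in> S \<Longrightarrow> v \<noteq> 0 \<Longrightarrow> g y v v > 0"
    and smooth: "smooth_on (\<lambda>y. g y u v) S"
begin

abbreviation \<Gamma> where "\<Gamma> \<equiv> levi_civita g"
abbreviation R where "R \<equiv> curvature \<Gamma>"

lemma dg: "x \<in> S \<Longrightarrow> (\<lambda>y. g y u v) differentiable (at x)"
  by (rule smooth_on_differentiable[OF smooth])

lemma ddg: "x \<in> S \<Longrightarrow> (\<lambda>y. dd (\<lambda>y. g y u v) y w) differentiable (at x)"
  by (rule smooth_on_differentiable[OF smooth_on_dd[OF smooth]])

lemma g_family: "x \<in> S \<Longrightarrow> bilinear_family S x g"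
  by (simp add: bilinear_family_def open_S bil dg)

lemma g_linear: "x \<in> S \<Longrightarrow> linear (g x u)" "x \<in> S \<Longrightarrow> linear (\<lambda>u. g x u v)"
  using bilinearD[OF bil] by auto

lemma g_simps:
  assumes "x \<in> S"
  shows "g x (u + v) w = g x u w + g x v w" "g x w (u + v) = g x w u + g x w v"
    "g x (u - v) w = g x u w - g x v w" "g x w (u - v) = g x w u - g x w v"
    "g x (r *\<^sub>R u) w = r * g x u w" "g x w (r *\<^sub>R u) = r * g x w u"
    "g x (- u) w = - g x u w" "g x w (- u) = - g x w u" "g x 0 w = 0" "g x w 0 = 0"
  using linear_add[OF g_linear(1)[OF assms]] linear_add[OF g_linear(2)[OF assms]]
    linear_diff[OF g_linear(1)[OF assms]] linear_diff[OF g_linear(2)[OF assms]]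
    linear_scale[OF g_linear(1)[OF assms]] linear_scale[OF g_linear(2)[OF assms]]
    linear_neg[OF g_linear(1)[OF assms]] linear_neg[OF g_linear(2)[OF assms]]
    linear_0[OF g_linear(1)[OF assms]] linear_0[OF g_linear(2)[OF assms]] by auto

lemma nondegenerate:
  assumes x: "x \<in> S" and eq: "\<And>z. g x a z = g x b z"
  shows "a = b"
  using pos[OF x, of "a - b"] eq[of "a - b"] by (auto simp: g_simps[OF x])

text \<open>The lowering of indices, with the covector stored as its vector of components, so that
  raising an index means solving a linear system within one space.\<close>

definition flat :: "'e \<Rightarrow> 'e \<Rightarrow> 'e" where
  "flat y u = (\<Sum>b\<in>Basis. g y u b *\<^sub>R b)"

lemma flat_inner: "y \<in> S \<Longrightarrow> flat y u \<bullet> z = g y u z"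
  using linear_basis_expand[OF g_linear(1), of y u z]
  by (simp add: flat_def inner_sum_left inner_commute[of z] mult.commute)

lemma flat_linear: "y \<in> S \<Longrightarrow> linear (flat y)"
  by (intro linearI) (simp_all add: flat_def g_simps algebra_simps sum.distrib scaleR_sum_right)

lemma flat_inj: "y \<in> S \<Longrightarrow> inj (flat y)"
  by (rule injI) (metis flat_inner nondegenerate)

lemma riesz:
  assumes x: "x \<in> S" and f: "linear f"
  shows "\<exists>t. \<forall>v. g x t v = f v"
proof -
  obtain t where t: "flat x t = (\<Sum>b\<in>Basis. f b *\<^sub>R b)"
    using linear_injective_imp_surjective[OF flat_linear flat_inj, OF x x] by (metis surjD)
  have "g x t v = f v" for v
    using linear_basis_expand[OF f, of v] flat_inner[OF x, of t v]
    by (simp add: t inner_sum_left inner_commute[of v] mult.commute)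
  then show ?thesis by blast
qed

text \<open>Supplies the differentiability of fields known only through their
  \<open>g\<close>-products: the Christoffel symbols, via the Koszul formula, and the dual field of
  a 1-form.\<close>

lemma sharp_differentiable:
  assumes x: "x \<in> S" and k: "\<And>b. (\<lambda>y. k y b) differentiable (at x)"
    and h: "\<And>y b. y \<in> S \<Longrightarrow> g y (h y) b = k y b"
  shows "h differentiable (at x)"
proof (rule differentiable_solution[where L = flat, OF open_S x flat_linear _ flat_inj[OF x]])
  show "(\<lambda>y. flat y u) differentiable (at x)" for u
    unfolding flat_def by (intro differentiable_sum ballI differentiable_scaleR dg x) auto
  show "(\<lambda>y. \<Sum>b\<in>Basis. k y b *\<^sub>R b) differentiable (at x)"
    by (intro differentiable_sum ballI differentiable_scaleR k) auto
  show "flat y (h y) = (\<Sum>b\<in>Basis. k y b *\<^sub>R b)" if "y \<in> S" for y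
    using h[OF that] by (simp add: flat_def)
qed

lemma weyl_characterization:
  assumes x: "x \<in> S" and \<theta>: "linear (\<theta> x)"
  shows "bilinear G \<and> (\<forall>u v. G u v = G v u) \<and>
     (\<forall>w u v. cov_metric g x G w u v = - 2 * \<theta> x w * g x u v) \<longleftrightarrow> G = weyl_connection g \<theta> x"
  by (rule weyl_connection_characterization[OF open_S x])
     (auto intro: bil g_sym pos dg x \<theta>)

lemma levi_civita:
  assumes x: "x \<in> S"
  shows LC_bilinear: "bilinear (\<Gamma> x)" and LC_sym: "\<Gamma> x u v = \<Gamma> x v u"
    and LC_metric: "dd (\<lambda>y. g y u v) x w = g x (\<Gamma> x w u) v + g x u (\<Gamma> x w v)"
proof -
  have "linear (\<lambda>v::'e. 0::real)" by (rule linear_zero)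
  from weyl_characterization[OF x, of "\<lambda>x v. 0" "\<Gamma> x", OF this]
  have *: "bilinear (\<Gamma> x)" "\<And>u v. \<Gamma> x u v = \<Gamma> x v u" "\<And>w u v. cov_metric g x (\<Gamma> x) w u v = 0"
    by (simp_all add: levi_civita_eq_weyl_connection)
  then show "bilinear (\<Gamma> x)" "\<Gamma> x u v = \<Gamma> x v u"
    by blast+
  show "dd (\<lambda>y. g y u v) x w = g x (\<Gamma> x w u) v + g x u (\<Gamma> x w v)"
    using *(3)[of w u v] by (simp add: cov_metric_def)
qed

lemma LC_linear: "x \<in> S \<Longrightarrow> linear (\<Gamma> x u)" "x \<in> S \<Longrightarrow> linear (\<lambda>u. \<Gamma> x u v)"
  using bilinearD[OF LC_bilinear] by auto

lemma LC_simps: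
  assumes "x \<in> S"
  shows "\<Gamma> x w (u + v) = \<Gamma> x w u + \<Gamma> x w v"
    "\<Gamma> x w (u - v) = \<Gamma> x w u - \<Gamma> x w v"
    "\<Gamma> x w (r *\<^sub>R u) = r *\<^sub>R \<Gamma> x w u" "\<Gamma> x w (- u) = - \<Gamma> x w u" "\<Gamma> x w 0 = 0"
  using linear_add[OF LC_linear(1)[OF assms]] linear_diff[OF LC_linear(1)[OF assms]]
    linear_scale[OF LC_linear(1)[OF assms]] linear_neg[OF LC_linear(1)[OF assms]]
    linear_0[OF LC_linear(1)[OF assms]] by auto

text \<open>The alternating sum of three instances of \<open>LC_metric\<close>. The bracket terms of
  the usual formula are absent because constant coordinate fields commute.\<close>

lemma koszul:
  assumes "x \<in> S"
  shows "g x (\<Gamma> x w u) z =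
    (dd (\<lambda>y. g y u z) x w + dd (\<lambda>y. g y w z) x u - dd (\<lambda>y. g y w u) x z) / 2"
  using LC_metric[OF assms, of u z w] LC_metric[OF assms, of w z u] LC_metric[OF assms, of w u z]
    g_sym[OF assms, of u "\<Gamma> x w z"] g_sym[OF assms, of w "\<Gamma> x u z"] g_sym[OF assms, of w "\<Gamma> x z u"]
    LC_sym[OF assms, of u w] LC_sym[OF assms, of z w] LC_sym[OF assms, of z u]
  by simp

lemma dLC:
  assumes "x \<in> S" shows "(\<lambda>y. \<Gamma> y w u) differentiable (at x)"
  by (rule sharp_differentiable[OF assms _ koszul])
     (intro differentiable_divide differentiable_add differentiable_diff ddg assms; simp)

lemma LC_family: "x \<in> S \<Longrightarrow> bilinear_family S x \<Gamma>"
  by (simp add: bilinear_family_def open_S LC_bilinear dLC)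

lemma dd_LC_sym: "x \<in> S \<Longrightarrow> dd (\<lambda>y. \<Gamma> y u v) x w = dd (\<lambda>y. \<Gamma> y v u) x w"
  by (rule fun_cong[OF dd_cong(1)[OF open_S]]) (auto intro: LC_sym dLC)

lemma R_antisym: "R x v u w = - R x u v w"
  by (simp add: curvature_def)

lemma bianchi:
  assumes "x \<in> S"
  shows "R x u v w + R x v w u + R x w u v = 0"
  by (simp add: curvature_def dd_LC_sym[OF assms, of u w] dd_LC_sym[OF assms, of v u]
      dd_LC_sym[OF assms, of w v] LC_sym[OF assms, of u w] LC_sym[OF assms, of v u]
      LC_sym[OF assms, of w v])

lemma R_linear: "x \<in> S \<Longrightarrow> linear (\<lambda>u. R x u v w)" "x \<in> S \<Longrightarrow> linear (\<lambda>w. R x u v w)"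
  by (rule curvature_linear[OF LC_family], assumption)+

text \<open>The second derivatives of \<open>g y w w\<close> in directions \<open>u\<close> and
  \<open>v\<close> are symmetric. Expanded by metric compatibility, the products of two first-order
  terms are symmetric too, and the remaining antisymmetric part is twice the left-hand side.\<close>

lemma R_skew_diag:
  assumes x: "x \<in> S" shows "g x (R x u v w) w = 0"
proof -
  have "dd (\<lambda>y. dd (\<lambda>y. g y w w) y v) x u =
      2 * (g x (\<Gamma> x u (\<Gamma> x v w)) w + g x (\<Gamma> x v w) (\<Gamma> x u w) + g x (dd (\<lambda>y. \<Gamma> y v w) x u) w)" for u v
  proof -
    have d: "(\<lambda>y. g y (\<Gamma> y v w) w) differentiable (at x)"
      by (rule dd_bilinear_family(1)[OF g_family[OF x] dLC[OF x]]) simp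
    have "dd (\<lambda>y. dd (\<lambda>y. g y w w) y v) x u = dd (\<lambda>y. g y (\<Gamma> y v w) w + g y (\<Gamma> y v w) w) x u"
      by (rule fun_cong[OF dd_cong(1)[OF open_S x]])
         (auto intro!: differentiable_add d simp: LC_metric g_sym[of _ w])
    also have "\<dots> = 2 * dd (\<lambda>y. g y (\<Gamma> y v w) w) x u"
      by (simp only: dd_add[OF d d] mult_2)
    also have "dd (\<lambda>y. g y (\<Gamma> y v w) w) x u =
        dd (\<lambda>y. g y (\<Gamma> x v w) w) x u + g x (dd (\<lambda>y. \<Gamma> y v w) x u) w"
      by (subst dd_bilinear_family(2)[OF g_family[OF x] dLC[OF x]]) (simp_all add: g_simps x)
    finally show ?thesis by (simp add: LC_metric x)
  qed
  from this[of v u] this[of u v] show ?thesis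
    using second_derivative_symmetric[OF open_S x dg ddg[OF x], of w w v u]
    by (simp add: curvature_def g_simps x g_sym[OF x, of "\<Gamma> x u w"])
qed

lemma R_skew:
  assumes x: "x \<in> S" shows "g x (R x u v w) z = - g x w (R x u v z)"
  using R_skew_diag[OF x, of u v "w + z"] R_skew_diag[OF x, of u v w] R_skew_diag[OF x, of u v z]
    g_sym[OF x, of w "R x u v z"]
  by (simp add: linear_add[OF R_linear(2)[OF x]] g_simps x)

text \<open>The case of pair symmetry that is needed: in the Bianchi identity for \<open>u\<close>,
  \<open>v\<close>, \<open>w\<close> paired with \<open>v\<close>, the term with
  \<open>R x w u v\<close> drops out by skewness.\<close>

lemma jacobi_operator_self_adjoint:
  assumes x: "x \<in> S" shows "g x (R x u v v) w = g x u (R x w v v)"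
  using bianchi[OF x, of u v w] R_skew[OF x, of u v w v] R_skew[OF x, of w u v v]
    g_simps(1)[OF x, of "R x u v w + R x v w u" "R x w u v" v] R_antisym[of x v w u]
    g_simps(1)[OF x, of "R x u v w" "R x v w u" v] R_skew[OF x, of w v u v]
    g_sym[OF x, of v "R x w u v"] g_sym[OF x, of w "R x u v v"]
  by (simp add: g_simps x)

lemma tr_skew:
  assumes x: "x \<in> S" and L: "linear L" "linear L'" "\<And>u v. g x (L u) v = - g x u (L' v)"
  shows "tr L = - tr L'"
  by (rule tr_skew_adjoint[OF bil[OF x] g_sym[OF x] pos[OF x] L])

text \<open>By the Bianchi identity the antisymmetric part is, up to sign, the trace of
  \<open>R x u v\<close>; this endomorphism is \<open>g\<close>-skew, so its trace equals its own
  negative.\<close>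

lemma ricci_sym:
  assumes x: "x \<in> S" shows "ricci \<Gamma> x u v = ricci \<Gamma> x v u"
proof -
  have "R x z u v - R x z v u = - R x u v z" for z
    using bianchi[OF x, of z u v] R_antisym[of x v z u] by (simp add: algebra_simps add_eq_0_iff)
  then have "ricci \<Gamma> x u v - ricci \<Gamma> x v u = - tr (\<lambda>z. R x u v z)"
    by (simp add: ricci_eq_tr flip: tr_diff tr_minus)
  moreover have "tr (\<lambda>z. R x u v z) = - tr (\<lambda>z. R x u v z)"
    by (rule tr_skew[OF x R_linear(2)[OF x] R_linear(2)[OF x] R_skew[OF x]])
  ultimately show ?thesis by simp
qed

end

section \<open>Curvature and Ricci tensor of a Weyl connection\<close>

locale weyl_chart = metric_chart S g
  for S :: "'e::euclidean_space set" and g :: "'e \<Rightarrow> 'e \<Rightarrow> 'e \<Rightarrow> real" +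
  fixes \<theta> :: "'e \<Rightarrow> 'e \<Rightarrow> real"
  assumes \<theta>_linear: "y \<in> S \<Longrightarrow> linear (\<theta> y)"
    and \<theta>_smooth: "smooth_on (\<lambda>y. \<theta> y v) S"
begin

text \<open>The \<open>g\<close>-dual vector field of \<theta>; existence on \<open>S\<close> comes
  from \<open>riesz\<close>.\<close>

definition T :: "'e \<Rightarrow> 'e" where
  "T y = (SOME t. \<forall>v. g y t v = \<theta> y v)"

text \<open>The difference tensor between the Weyl connection and the Levi-Civita
  connection.\<close>

definition \<Delta> :: "'e \<Rightarrow> 'e \<Rightarrow> 'e \<Rightarrow> 'e" where
  "\<Delta> y u v = \<theta> y u *\<^sub>R v + \<theta> y v *\<^sub>R u - g y u v *\<^sub>R T y"

definition cov_\<theta> :: "'e \<Rightarrow> 'e \<Rightarrow> 'e \<Rightarrow> real" where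
  "cov_\<theta> x u v = dd (\<lambda>y. \<theta> y v) x u - \<theta> x (\<Gamma> x u v)"

definition cov_T :: "'e \<Rightarrow> 'e \<Rightarrow> 'e" where
  "cov_T x u = dd T x u + \<Gamma> x u (T x)"

lemma d\<theta>: "x \<in> S \<Longrightarrow> (\<lambda>y. \<theta> y v) differentiable (at x)"
  by (rule smooth_on_differentiable[OF \<theta>_smooth])

lemma \<theta>_simps:
  assumes "x \<in> S"
  shows "\<theta> x (u + v) = \<theta> x u + \<theta> x v" "\<theta> x (u - v) = \<theta> x u - \<theta> x v"
    "\<theta> x (r *\<^sub>R u) = r * \<theta> x u" "\<theta> x (- u) = - \<theta> x u" "\<theta> x 0 = 0"
  using linear_add[OF \<theta>_linear[OF assms]] linear_diff[OF \<theta>_linear[OF assms]]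
    linear_scale[OF \<theta>_linear[OF assms]] linear_neg[OF \<theta>_linear[OF assms]]
    linear_0[OF \<theta>_linear[OF assms]] by auto

lemma g_T: "y \<in> S \<Longrightarrow> g y (T y) v = \<theta> y v"
  unfolding T_def using someI_ex[OF riesz[OF _ \<theta>_linear]] by blast

lemma dT: "x \<in> S \<Longrightarrow> T differentiable (at x)"
  by (rule sharp_differentiable[OF _ d\<theta> g_T])

text \<open>By uniqueness in \<open>weyl_characterization\<close> it suffices that the explicit
  formula is symmetric, bilinear and has the prescribed effect on the metric.\<close>

lemma weyl_eq:
  assumes y: "y \<in> S" shows "weyl_connection g \<theta> y u v = \<Gamma> y u v + \<Delta> y u v"
proof -
  have "(\<lambda>u v. \<Gamma> y u v + \<Delta> y u v) = weyl_connection g \<theta> y"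
  proof (rule weyl_characterization[where \<theta> = \<theta>, OF y \<theta>_linear[OF y], THEN iffD1], intro conjI allI)
    show "bilinear (\<lambda>u v. \<Gamma> y u v + \<Delta> y u v)"
      unfolding bilinear_def \<Delta>_def
      by (auto intro!: linearI simp: linear_add[OF LC_linear(1)[OF y]] linear_add[OF LC_linear(2)[OF y]]
          linear_scale[OF LC_linear(1)[OF y]] linear_scale[OF LC_linear(2)[OF y]]
          g_simps[OF y] \<theta>_simps[OF y] algebra_simps)
    show "\<Gamma> y u v + \<Delta> y u v = \<Gamma> y v u + \<Delta> y v u" for u v
      by (simp add: \<Delta>_def LC_sym[OF y, of u v] g_sym[OF y, of u v])
    show "cov_metric g y (\<lambda>u v. \<Gamma> y u v + \<Delta> y u v) w u v = - 2 * \<theta> y w * g y u v" for w u v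
      by (simp add: cov_metric_def \<Delta>_def LC_metric[OF y] g_simps[OF y] g_T[OF y]
          g_sym[OF y, of u "T y"] g_sym[OF y, of v w] g_sym[OF y, of w u] algebra_simps)
  qed
  then show ?thesis by metis
qed

text \<open>Raising an index commutes with covariant differentiation because the metric is
  parallel.\<close>

lemma g_cov_T:
  assumes x: "x \<in> S" shows "g x (cov_T x u) w = cov_\<theta> x u w"
proof -
  have "dd (\<lambda>y. \<theta> y w) x u = dd (\<lambda>y. g y (T y) w) x u"
    by (rule fun_cong[OF dd_cong(1)[OF open_S x]])
       (auto simp: g_T intro!: dd_bilinear_family(1)[OF g_family[OF x]] dT x)
  also have "\<dots> = g x (\<Gamma> x u (T x)) w + g x (T x) (\<Gamma> x u w) + g x (dd T x u) w"
    by (subst dd_bilinear_family(2)[OF g_family[OF x] dT[OF x]]) (simp_all add: g_simps x LC_metric)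
  finally show ?thesis by (simp add: cov_T_def cov_\<theta>_def g_simps x g_T)
qed

lemma cov_linear:
  assumes x: "x \<in> S"
  shows "linear (\<lambda>u. cov_\<theta> x u v)" "linear (cov_\<theta> x u)" "linear (cov_T x)"
proof -
  note a = linear_dd[OF d\<theta>[OF x]] and b = linear_dd_family[OF open_S x \<theta>_linear d\<theta>[OF x]]
    and c = linear_dd[OF dT[OF x]] and d = LC_linear[OF x]
  show "linear (\<lambda>u. cov_\<theta> x u v)" unfolding cov_\<theta>_def
    by (intro linearI) (simp_all add: linear_add[OF a] linear_scale[OF a] linear_add[OF d(2)]
        linear_scale[OF d(2)] \<theta>_simps[OF x] algebra_simps)
  show "linear (cov_\<theta> x u)" unfolding cov_\<theta>_def
    by (intro linearI) (simp_all add: linear_add[OF b] linear_scale[OF b] linear_add[OF d(1)]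
        linear_scale[OF d(1)] \<theta>_simps[OF x] algebra_simps)
  show "linear (cov_T x)" unfolding cov_T_def
    by (intro linearI) (simp_all add: linear_add[OF c] linear_scale[OF c] linear_add[OF d(2)]
        linear_scale[OF d(2)] algebra_simps)
qed

lemma dd_\<Delta>:
  assumes x: "x \<in> S"
  shows "(\<lambda>y. \<Delta> y v w) differentiable (at x)"
    and "dd (\<lambda>y. \<Delta> y v w) x u = dd (\<lambda>y. \<theta> y v) x u *\<^sub>R w + dd (\<lambda>y. \<theta> y w) x u *\<^sub>R v
      - (g x (\<Gamma> x u v) w + g x v (\<Gamma> x u w)) *\<^sub>R T x - g x v w *\<^sub>R dd T x u"
proof -
  note d = d\<theta>[OF x] dg[OF x] dT[OF x] LC_metric[OF x]
  show "(\<lambda>y. \<Delta> y v w) differentiable (at x)" unfolding \<Delta>_def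
    by (intro differentiable_diff differentiable_add differentiable_scaleR d) auto
  show "dd (\<lambda>y. \<Delta> y v w) x u = dd (\<lambda>y. \<theta> y v) x u *\<^sub>R w + dd (\<lambda>y. \<theta> y w) x u *\<^sub>R v
      - (g x (\<Gamma> x u v) w + g x v (\<Gamma> x u w)) *\<^sub>R T x - g x v w *\<^sub>R dd T x u"
    unfolding \<Delta>_def
    by (simp add: dd_diff dd_add dd_scaleR d algebra_simps differentiable_diff differentiable_add differentiable_scaleR)
qed

text \<open>The curvature of \<nabla> + \<Delta> is that of \<nabla>, plus the antisymmetrised
  covariant derivative of \<Delta> (\<open>dA\<close>), plus the commutator of \<Delta> with itself
  (\<open>AA\<close>). Since \<nabla> is torsion-free and preserves \<open>g\<close>, only
  \<nabla>\<theta> and its dual survive in \<open>dA\<close>.\<close>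

lemma curvature_weyl:
  assumes x: "x \<in> S"
  shows "curvature (weyl_connection g \<theta>) x u v w = R x u v w
    + (cov_\<theta> x u v *\<^sub>R w + cov_\<theta> x u w *\<^sub>R v - g x v w *\<^sub>R cov_T x u)
    - (cov_\<theta> x v u *\<^sub>R w + cov_\<theta> x v w *\<^sub>R u - g x u w *\<^sub>R cov_T x v)
    + (\<theta> x v * \<theta> x w) *\<^sub>R u - (\<theta> x u * \<theta> x w) *\<^sub>R v
    - (\<theta> x v * g x u w) *\<^sub>R T x + (\<theta> x u * g x v w) *\<^sub>R T x
    - (\<theta> x (T x) * g x v w) *\<^sub>R u + (\<theta> x (T x) * g x u w) *\<^sub>R v"
proof -
  have dW: "dd (\<lambda>y. weyl_connection g \<theta> y v w) x u = dd (\<lambda>y. \<Gamma> y v w) x u + dd (\<lambda>y. \<Delta> y v w) x u" for u v w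
  proof -
    have "dd (\<lambda>y. weyl_connection g \<theta> y v w) x u = dd (\<lambda>y. \<Gamma> y v w + \<Delta> y v w) x u"
      by (rule fun_cong[OF dd_cong(1)[OF open_S x]])
         (auto simp: weyl_eq intro!: differentiable_add dLC dd_\<Delta> x)
    then show ?thesis by (simp add: dd_add dLC dd_\<Delta>(1) x)
  qed
  have W: "weyl_connection g \<theta> x u (weyl_connection g \<theta> x v w) =
      \<Gamma> x u (\<Gamma> x v w) + \<Gamma> x u (\<Delta> x v w) + \<Delta> x u (\<Gamma> x v w) + \<Delta> x u (\<Delta> x v w)" for u v w
    by (simp add: weyl_eq x LC_simps \<Delta>_def \<theta>_simps g_simps algebra_simps)
  have TT: "g x u (T x) = \<theta> x u" for u using g_T[OF x] g_sym[OF x] by simp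
  have two: "(2 * c) *\<^sub>R z = c *\<^sub>R z + c *\<^sub>R z" for c and z :: 'e
    by (simp only: mult_2 scaleR_left_distrib)
  have AA: "\<Delta> x u (\<Delta> x v w) - \<Delta> x v (\<Delta> x u w) = (\<theta> x v * \<theta> x w) *\<^sub>R u - (\<theta> x u * \<theta> x w) *\<^sub>R v
    - (\<theta> x v * g x u w) *\<^sub>R T x + (\<theta> x u * g x v w) *\<^sub>R T x
    - (\<theta> x (T x) * g x v w) *\<^sub>R u + (\<theta> x (T x) * g x u w) *\<^sub>R v"
    by (simp add: \<Delta>_def \<theta>_simps g_simps x TT g_sym[OF x, of v u] two algebra_simps)
  have dA: "dd (\<lambda>y. \<Delta> y v w) x u - dd (\<lambda>y. \<Delta> y u w) x v
      + \<Gamma> x u (\<Delta> x v w) + \<Delta> x u (\<Gamma> x v w) - \<Gamma> x v (\<Delta> x u w) - \<Delta> x v (\<Gamma> x u w) =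
     (cov_\<theta> x u v *\<^sub>R w + cov_\<theta> x u w *\<^sub>R v - g x v w *\<^sub>R cov_T x u)
    - (cov_\<theta> x v u *\<^sub>R w + cov_\<theta> x v w *\<^sub>R u - g x u w *\<^sub>R cov_T x v)"
    unfolding dd_\<Delta>(2)[OF x]
    by (simp add: \<Delta>_def cov_\<theta>_def cov_T_def \<theta>_simps g_simps LC_simps x
        LC_sym[OF x, of v u] algebra_simps)
  have "curvature (weyl_connection g \<theta>) x u v w = R x u v w
    + (dd (\<lambda>y. \<Delta> y v w) x u - dd (\<lambda>y. \<Delta> y u w) x v
      + \<Gamma> x u (\<Delta> x v w) + \<Delta> x u (\<Gamma> x v w) - \<Gamma> x v (\<Delta> x u w) - \<Delta> x v (\<Gamma> x u w))
    + (\<Delta> x u (\<Delta> x v w) - \<Delta> x v (\<Delta> x u w))"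
    unfolding curvature_def dW W by simp
  then show ?thesis unfolding AA dA by simp
qed

lemma ricci_weyl:
  fixes v w
  assumes x: "x \<in> S"
  defines "N \<equiv> real DIM('e)"
  shows "ricci (weyl_connection g \<theta>) x v w = ricci \<Gamma> x v w + cov_\<theta> x w v - (N - 1) * cov_\<theta> x v w
    - tr (cov_T x) * g x v w + (N - 2) * (\<theta> x v * \<theta> x w - \<theta> x (T x) * g x v w)"
proof -
  have 1: "tr (\<lambda>u. cov_\<theta> x u v *\<^sub>R w) = cov_\<theta> x w v" for v w
    by (rule tr_rank_one[OF cov_linear(1)[OF x]])
  have 2: "tr (\<lambda>u. cov_\<theta> x v u *\<^sub>R w) = cov_\<theta> x v w"
    by (rule tr_rank_one[OF cov_linear(2)[OF x]])
  have 3: "tr (\<lambda>u. (\<theta> x u * c) *\<^sub>R w) = \<theta> x w * c" for w c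
    using tr_rank_one[OF \<theta>_linear[OF x], of "c *\<^sub>R w"] by (simp add: \<theta>_simps x mult.commute)
  have 4: "tr (\<lambda>u. (c * g x u w) *\<^sub>R z) = c * g x z w" for w z c
    using tr_rank_one[OF g_linear(2)[OF x], of w "c *\<^sub>R z"] by (simp add: g_simps x mult.commute)
  have 5: "tr (\<lambda>u. g x u w *\<^sub>R z) = g x z w" for w z
    using 4[of 1] by simp
  show ?thesis
    unfolding ricci_eq_tr curvature_weyl[OF x]
    by (simp only: tr_add tr_diff tr_scale 1 2 3 4 5 tr_id g_cov_T[OF x] g_T[OF x])
       (simp add: N_def algebra_simps)
qed

text \<open>Symmetrising removes the antisymmetric part of \<nabla>\<theta>, that is d\<theta>. The
  first line is even in \<theta> and the second odd; \<open>tr (cov_T x)\<close> is the divergence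
  of the dual field.\<close>

lemma ricci_weyl_symmetrized:
  fixes v w
  assumes x: "x \<in> S"
  defines "N \<equiv> real DIM('e)"
  shows "ricci (weyl_connection g \<theta>) x v w + ricci (weyl_connection g \<theta>) x w v =
    2 * (ricci \<Gamma> x v w + (N - 2) * \<theta> x v * \<theta> x w - (N - 2) * \<theta> x (T x) * g x v w)
    - ((N - 2) * (cov_\<theta> x v w + cov_\<theta> x w v) + 2 * tr (cov_T x) * g x v w)"
  using ricci_weyl[OF x, of v w] ricci_weyl[OF x, of w v] ricci_sym[OF x, of v w] g_sym[OF x, of v w]
  by (simp add: N_def algebra_simps)

end

subsection \<open>Sasakian structures\<close>

locale sasaki_chart = metric_chart S g
  for S :: "'e::euclidean_space set" and g :: "'e \<Rightarrow> 'e \<Rightarrow> 'e \<Rightarrow> real" +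
  fixes \<xi> :: "'e \<Rightarrow> 'e" and \<eta> :: "'e \<Rightarrow> 'e \<Rightarrow> real" and \<Phi> :: "'e \<Rightarrow> 'e \<Rightarrow> 'e"
  assumes \<eta>_linear: "y \<in> S \<Longrightarrow> linear (\<eta> y)"
    and \<Phi>_linear: "y \<in> S \<Longrightarrow> linear (\<Phi> y)"
    and \<xi>_smooth: "smooth_on \<xi> S"
    and \<eta>_smooth: "smooth_on (\<lambda>y. \<eta> y v) S"
    and \<Phi>_smooth: "smooth_on (\<lambda>y. \<Phi> y v) S"
    and \<eta>_\<xi>: "y \<in> S \<Longrightarrow> \<eta> y (\<xi> y) = 1"
    and \<Phi>_\<Phi>: "y \<in> S \<Longrightarrow> \<Phi> y (\<Phi> y v) = - v + \<eta> y v *\<^sub>R \<xi> y"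
    and g_\<Phi>_\<Phi>: "y \<in> S \<Longrightarrow> g y (\<Phi> y u) (\<Phi> y v) = g y u v - \<eta> y u * \<eta> y v"
    and cov_\<Phi>: "y \<in> S \<Longrightarrow> cov_endo \<Phi> y (levi_civita g y) u v = g y u v *\<^sub>R \<xi> y - \<eta> y v *\<^sub>R u"
begin

lemma d\<xi>: "x \<in> S \<Longrightarrow> \<xi> differentiable (at x)"
  and d\<eta>: "x \<in> S \<Longrightarrow> (\<lambda>y. \<eta> y v) differentiable (at x)"
  and d\<Phi>: "x \<in> S \<Longrightarrow> (\<lambda>y. \<Phi> y v) differentiable (at x)"
  and dd\<xi>: "x \<in> S \<Longrightarrow> (\<lambda>y. dd \<xi> y w) differentiable (at x)"
  and dd\<Phi>: "x \<in> S \<Longrightarrow> (\<lambda>y. dd (\<lambda>y. \<Phi> y v) y w) differentiable (at x)"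
  by (rule smooth_on_differentiable[OF \<xi>_smooth] smooth_on_differentiable[OF \<eta>_smooth]
      smooth_on_differentiable[OF \<Phi>_smooth] smooth_on_differentiable[OF smooth_on_dd[OF \<xi>_smooth]]
      smooth_on_differentiable[OF smooth_on_dd[OF \<Phi>_smooth]], assumption)+

lemma \<eta>_simps:
  assumes "x \<in> S"
  shows "\<eta> x (u + v) = \<eta> x u + \<eta> x v" "\<eta> x (u - v) = \<eta> x u - \<eta> x v"
    "\<eta> x (r *\<^sub>R u) = r * \<eta> x u" "\<eta> x (- u) = - \<eta> x u" "\<eta> x 0 = 0"
  using linear_add[OF \<eta>_linear[OF assms]] linear_diff[OF \<eta>_linear[OF assms]]
    linear_scale[OF \<eta>_linear[OF assms]] linear_neg[OF \<eta>_linear[OF assms]]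
    linear_0[OF \<eta>_linear[OF assms]] by auto

lemma \<Phi>_simps:
  assumes "x \<in> S"
  shows "\<Phi> x (u + v) = \<Phi> x u + \<Phi> x v" "\<Phi> x (u - v) = \<Phi> x u - \<Phi> x v"
    "\<Phi> x (r *\<^sub>R u) = r *\<^sub>R \<Phi> x u" "\<Phi> x (- u) = - \<Phi> x u" "\<Phi> x 0 = 0"
  using linear_add[OF \<Phi>_linear[OF assms]] linear_diff[OF \<Phi>_linear[OF assms]]
    linear_scale[OF \<Phi>_linear[OF assms]] linear_neg[OF \<Phi>_linear[OF assms]]
    linear_0[OF \<Phi>_linear[OF assms]] by auto

lemma \<xi>_nonzero: "x \<in> S \<Longrightarrow> \<xi> x \<noteq> 0"
  using \<eta>_\<xi>[of x] \<eta>_simps(5)[of x] by auto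

text \<open>\<Phi>\<Phi>\<xi> = 0, so the formula for the square of \<Phi>, applied to \<Phi>\<xi>,
  gives \<Phi>\<xi> = k\<xi>. A second application of \<Phi> then shows k * k = 0.\<close>

lemma \<Phi>_\<xi>:
  assumes x: "x \<in> S" shows "\<Phi> x (\<xi> x) = 0"
proof -
  have 0: "\<Phi> x (\<Phi> x (\<xi> x)) = 0" by (simp add: \<Phi>_\<Phi> \<eta>_\<xi> x)
  then have eq: "\<Phi> x (\<xi> x) = \<eta> x (\<Phi> x (\<xi> x)) *\<^sub>R \<xi> x"
    using \<Phi>_\<Phi>[OF x, of "\<Phi> x (\<xi> x)"] by (simp add: \<Phi>_simps x)
  define k where "k = \<eta> x (\<Phi> x (\<xi> x))"
  have "\<Phi> x (\<Phi> x (\<xi> x)) = (k * k) *\<^sub>R \<xi> x"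
    using eq unfolding k_def by (metis \<Phi>_simps(3) scaleR_scaleR x)
  then have "k = 0" using 0 \<xi>_nonzero[OF x] by simp
  then show ?thesis using eq by (simp add: k_def)
qed

lemma g_\<xi>:
  assumes x: "x \<in> S" shows "g x u (\<xi> x) = \<eta> x u" "g x (\<xi> x) u = \<eta> x u"
  using g_\<Phi>_\<Phi>[OF x, of u "\<xi> x"] g_sym[OF x, of u "\<xi> x"] by (auto simp: \<Phi>_\<xi> \<eta>_\<xi> g_simps x)

lemma \<eta>_\<Phi>:
  assumes x: "x \<in> S" shows "\<eta> x (\<Phi> x u) = 0"
proof -
  have "\<Phi> x (\<Phi> x (\<Phi> x u)) = - \<Phi> x u + \<eta> x (\<Phi> x u) *\<^sub>R \<xi> x" by (rule \<Phi>_\<Phi>[OF x])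
  moreover have "\<Phi> x (\<Phi> x (\<Phi> x u)) = - \<Phi> x u"
    by (subst \<Phi>_\<Phi>[OF x]) (simp add: \<Phi>_simps \<Phi>_\<xi> x)
  ultimately show ?thesis using \<xi>_nonzero[OF x] by simp
qed

lemma \<Phi>_skew:
  assumes x: "x \<in> S" shows "g x (\<Phi> x u) v = - g x u (\<Phi> x v)"
  using g_\<Phi>_\<Phi>[OF x, of "\<Phi> x u" v] by (simp add: \<Phi>_\<Phi> g_simps g_\<xi> \<eta>_\<Phi> x)

lemma dd_\<Phi>:
  assumes x: "x \<in> S"
  shows "dd (\<lambda>y. \<Phi> y v) x u = g x u v *\<^sub>R \<xi> x - \<eta> x v *\<^sub>R u - \<Gamma> x u (\<Phi> x v) + \<Phi> x (\<Gamma> x u v)"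
  using cov_\<Phi>[OF x, of u v] by (simp add: cov_endo_def algebra_simps)

text \<open>This is \<nabla>\<xi> = -\<Phi>. Differentiating \<Phi>\<xi> = 0 determines
  \<nabla>\<xi> up to the kernel of \<Phi>, and differentiating g(\<xi>, \<xi>) = 1 removes its
  component along \<xi>.\<close>

lemma dd_\<xi>:
  assumes x: "x \<in> S" shows "dd \<xi> x u = - \<Phi> x u - \<Gamma> x u (\<xi> x)"
proof -
  define X where "X = dd \<xi> x u + \<Gamma> x u (\<xi> x)"
  have "dd (\<lambda>y. \<Phi> y (\<xi> y)) x u = dd (\<lambda>y. 0) x u"
    by (rule fun_cong[OF dd_cong(1)[OF open_S x]]) (simp_all add: \<Phi>_\<xi>)
  then have "dd (\<lambda>y. \<Phi> y (\<xi> x)) x u + \<Phi> x (dd \<xi> x u) = 0"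
    by (simp add: dd_linear_family(2)[OF open_S x \<Phi>_linear d\<Phi>[OF x] d\<xi>[OF x]] frechet_derivative_const)
  then have \<Phi>X: "\<Phi> x X = u - \<eta> x u *\<^sub>R \<xi> x"
    by (simp add: dd_\<Phi> x X_def \<Phi>_simps \<Phi>_\<xi> g_\<xi> \<eta>_\<xi> LC_simps algebra_simps add_eq_0_iff)
  have "dd (\<lambda>y. g y (\<xi> y) (\<xi> y)) x u = dd (\<lambda>y. 1) x u"
    by (rule fun_cong[OF dd_cong(1)[OF open_S x]]) (simp_all add: g_\<xi> \<eta>_\<xi>)
  then have "2 * g x X (\<xi> x) = 0"
    by (simp add: dd_bilinear_family(2)[OF g_family[OF x] d\<xi>[OF x] d\<xi>[OF x]] frechet_derivative_const
        LC_metric x g_\<xi> X_def \<eta>_simps)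
  then have "\<eta> x X = 0" by (simp add: g_\<xi> x)
  then have "X = - \<Phi> x (\<Phi> x X)" by (simp add: \<Phi>_\<Phi> x)
  also have "\<dots> = - \<Phi> x u" by (simp add: \<Phi>X \<Phi>_simps \<Phi>_\<xi> x)
  finally show ?thesis by (simp add: X_def algebra_simps)
qed

text \<open>With \<open>\<Phi>_skew\<close> this says that \<nabla>\<eta> is skew, which is the
  Killing property of \<xi>.\<close>

lemma dd_\<eta>:
  assumes x: "x \<in> S" shows "dd (\<lambda>y. \<eta> y v) x u = \<eta> x (\<Gamma> x u v) - g x (\<Phi> x u) v"
proof -
  have "dd (\<lambda>y. \<eta> y v) x u = dd (\<lambda>y. g y v (\<xi> y)) x u"
    by (rule fun_cong[OF dd_cong(1)[OF open_S x]])
       (auto simp: g_\<xi> intro!: dd_bilinear_family(1)[OF g_family[OF x]] d\<xi> x)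
  also have "\<dots> = \<eta> x (\<Gamma> x u v) - g x v (\<Phi> x u)"
    by (subst dd_bilinear_family(2)[OF g_family[OF x] _ d\<xi>[OF x]])
       (simp_all add: g_simps x LC_metric dd_\<xi> g_\<xi> \<eta>_simps)
  finally show ?thesis by (simp add: g_sym[OF x, of v])
qed

text \<open>Since \<nabla>\<xi> = -\<Phi>, the curvature applied to \<xi> is the antisymmetrised
  \<nabla>\<Phi>, which the Sasakian condition gives explicitly.\<close>

lemma R_\<xi>:
  assumes x: "x \<in> S" shows "R x u v (\<xi> x) = \<eta> x v *\<^sub>R u - \<eta> x u *\<^sub>R v"
proof -
  have "dd (\<lambda>y. dd \<xi> y v) x u = - dd (\<lambda>y. \<Phi> y v) x u - dd (\<lambda>y. \<Gamma> y v (\<xi> x)) x u - \<Gamma> x v (dd \<xi> x u)" for u v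
  proof -
    have d: "(\<lambda>y. \<Gamma> y v (\<xi> y)) differentiable (at x)"
      by (rule dd_linear_family(1)[OF open_S x LC_linear(1) dLC[OF x] d\<xi>[OF x]])
    have "dd (\<lambda>y. dd \<xi> y v) x u = dd (\<lambda>y. - \<Phi> y v - \<Gamma> y v (\<xi> y)) x u"
      by (rule fun_cong[OF dd_cong(1)[OF open_S x]])
         (auto simp: dd_\<xi> intro!: differentiable_diff differentiable_minus d d\<Phi> x)
    also have "\<dots> = - dd (\<lambda>y. \<Phi> y v) x u - dd (\<lambda>y. \<Gamma> y v (\<xi> y)) x u"
      by (simp add: dd_diff dd_minus differentiable_minus d d\<Phi> x)
    finally show ?thesis
      by (simp add: dd_linear_family(2)[OF open_S x LC_linear(1) dLC[OF x] d\<xi>[OF x]])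
  qed
  from this[of u v] this[of v u] show ?thesis
    using second_derivative_symmetric[OF open_S x d\<xi> dd\<xi>[OF x], of u v]
    by (simp add: curvature_def dd_\<Phi> dd_\<xi> LC_simps LC_sym[OF x, of v u] g_sym[OF x, of v u] x
        algebra_simps add_eq_0_iff)
qed

lemma ricci_\<xi>:
  assumes x: "x \<in> S" shows "ricci \<Gamma> x u (\<xi> x) = (DIM('e) - 1) * \<eta> x u"
  by (simp add: ricci_eq_tr R_\<xi> x tr_diff tr_scale tr_id tr_rank_one[OF \<eta>_linear[OF x]] algebra_simps
      of_nat_diff Suc_leI)

text \<open>The Ricci identity for \<Phi>: the commutator of second covariant derivatives is
  computed by differentiating the Sasakian condition and inserting \<nabla>\<xi> and
  \<nabla>\<eta>.\<close>

lemma R_\<Phi>: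
  assumes x: "x \<in> S"
  shows "R x u v (\<Phi> x w) - \<Phi> x (R x u v w) =
    - g x v w *\<^sub>R \<Phi> x u + g x (\<Phi> x u) w *\<^sub>R v + g x u w *\<^sub>R \<Phi> x v - g x (\<Phi> x v) w *\<^sub>R u"
proof -
  have "dd (\<lambda>y. dd (\<lambda>y. \<Phi> y w) y v) x u =
      (g x (\<Gamma> x u v) w + g x v (\<Gamma> x u w)) *\<^sub>R \<xi> x + g x v w *\<^sub>R dd \<xi> x u - dd (\<lambda>y. \<eta> y w) x u *\<^sub>R v
      - (dd (\<lambda>y. \<Gamma> y v (\<Phi> x w)) x u + \<Gamma> x v (dd (\<lambda>y. \<Phi> y w) x u))
      + (dd (\<lambda>y. \<Phi> y (\<Gamma> x v w)) x u + \<Phi> x (dd (\<lambda>y. \<Gamma> y v w) x u))" for u v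
  proof -
    note a = dd_linear_family[where L = "\<lambda>y. \<Gamma> y v" and F = "\<lambda>y. \<Phi> y w",
        OF open_S x LC_linear(1) dLC[OF x] d\<Phi>[OF x]]
    note b = dd_linear_family[where L = \<Phi> and F = "\<lambda>y. \<Gamma> y v w",
        OF open_S x \<Phi>_linear d\<Phi>[OF x] dLC[OF x]]
    note d = a(1) b(1) dg[OF x] d\<xi>[OF x] d\<eta>[OF x]
    have "dd (\<lambda>y. dd (\<lambda>y. \<Phi> y w) y v) x u =
       dd (\<lambda>y. g y v w *\<^sub>R \<xi> y - \<eta> y w *\<^sub>R v - \<Gamma> y v (\<Phi> y w) + \<Phi> y (\<Gamma> y v w)) x u"
      by (rule fun_cong[OF dd_cong(1)[OF open_S x]])
         (auto simp: dd_\<Phi> intro!: differentiable_diff differentiable_add differentiable_scaleR d)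
    also have "\<dots> = (g x (\<Gamma> x u v) w + g x v (\<Gamma> x u w)) *\<^sub>R \<xi> x + g x v w *\<^sub>R dd \<xi> x u
        - dd (\<lambda>y. \<eta> y w) x u *\<^sub>R v - dd (\<lambda>y. \<Gamma> y v (\<Phi> y w)) x u + dd (\<lambda>y. \<Phi> y (\<Gamma> y v w)) x u"
      by (simp add: dd_diff dd_add dd_scaleR d differentiable_diff differentiable_add
          differentiable_scaleR LC_metric x)
    finally show ?thesis by (simp add: a(2) b(2))
  qed
  from this[of u v] this[of v u] show ?thesis
    using second_derivative_symmetric[OF open_S x d\<Phi> dd\<Phi>[OF x], of w u v]
    by (simp add: curvature_def dd_\<Phi> dd_\<xi> dd_\<eta> LC_simps \<Phi>_simps g_simps \<eta>_simps
        LC_sym[OF x, of v u] g_sym[OF x, of v u] x algebra_simps add_eq_0_iff)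
qed

lemma tr_\<Phi>: "x \<in> S \<Longrightarrow> tr (\<Phi> x) = 0"
  using tr_skew[OF _ \<Phi>_linear \<Phi>_linear \<Phi>_skew] by fastforce

text \<open>
  Tracing \<open>R_\<Phi>\<close> leaves the trace of \<open>\<Phi>\<close> composed with the Jacobi operator, which vanishes since one is
  skew and the other self-adjoint.
\<close>

lemma ricci_\<Phi>:
  assumes x: "x \<in> S" shows "ricci \<Gamma> x v (\<Phi> x v) = 0"
proof -
  have g0: "g x (\<Phi> x v) v = 0" using \<Phi>_skew[OF x, of v v] g_sym[OF x, of v "\<Phi> x v"] by simp
  have l1: "linear (\<lambda>u. R x u v v)" by (rule R_linear[OF x])
  have "tr (\<lambda>u. \<Phi> x (R x u v v)) = - tr (\<lambda>u. R x (\<Phi> x u) v v)"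
  proof (rule tr_skew[OF x])
    show "linear (\<lambda>u. \<Phi> x (R x u v v))" "linear (\<lambda>u. R x (\<Phi> x u) v v)"
      using linear_compose[OF l1 \<Phi>_linear[OF x]] linear_compose[OF \<Phi>_linear[OF x] l1] by (auto simp: o_def)
    show "g x (\<Phi> x (R x u v v)) w = - g x u (R x (\<Phi> x w) v v)" for u w
      using \<Phi>_skew[OF x, of "R x u v v" w] jacobi_operator_self_adjoint[OF x, of u v "\<Phi> x w"] by simp
  qed
  moreover have "tr (\<lambda>u. \<Phi> x (R x u v v)) = tr (\<lambda>u. R x (\<Phi> x u) v v)"
    by (rule tr_commute[OF \<Phi>_linear[OF x] l1])
  ultimately have J: "tr (\<lambda>u. \<Phi> x (R x u v v)) = 0" by simp
  have "R x u v (\<Phi> x v) = \<Phi> x (R x u v v) + ((- g x v v) *\<^sub>R \<Phi> x u + g x (\<Phi> x u) v *\<^sub>R v + g x u v *\<^sub>R \<Phi> x v)" for u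
    using R_\<Phi>[OF x, of u v v] by (simp add: g0 algebra_simps)
  then have "ricci \<Gamma> x v (\<Phi> x v) = tr (\<lambda>u. g x (\<Phi> x u) v *\<^sub>R v) + tr (\<lambda>u. g x u v *\<^sub>R \<Phi> x v)"
    by (simp only: ricci_eq_tr tr_add tr_scale J tr_\<Phi>[OF x])
  also have "\<dots> = g x (\<Phi> x v) v + g x (\<Phi> x v) v"
    using tr_rank_one[OF linear_compose[OF \<Phi>_linear[OF x] g_linear(2)[OF x]], of v v]
      tr_rank_one[OF g_linear(2)[OF x], of v "\<Phi> x v"] by (simp add: o_def)
  finally show ?thesis by (simp add: g0)
qed

lemma form_proportional_\<eta>:
  fixes f c :: real
  assumes x: "x \<in> S" and \<theta>: "linear \<theta>" and c: "c \<noteq> 0"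
    and ric: "\<And>u v. ricci \<Gamma> x u v = f * g x u v - c * \<theta> u * \<theta> v"
  shows "\<theta> v = \<theta> (\<xi> x) * \<eta> x v"
    and "f = DIM('e) - 1 + c * (\<theta> (\<xi> x))\<^sup>2"
proof -
  have prod0: "\<theta> v * \<theta> (\<Phi> x v) = 0" for v
  proof -
    have "g x v (\<Phi> x v) = 0" using \<Phi>_skew[OF x, of v v] g_sym[OF x, of v "\<Phi> x v"] by linarith
    then have "c * \<theta> v * \<theta> (\<Phi> x v) = 0" using ricci_\<Phi>[OF x, of v] ric[of v "\<Phi> x v"] by simp
    then show ?thesis using c by simp
  qed
  have ker: "\<theta> w = 0" if "\<eta> x w = 0" for w
  proof -
    have "\<Phi> x (w + \<Phi> x w) = \<Phi> x w - w" by (simp add: \<Phi>_simps \<Phi>_\<Phi> x that)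
    \<comment> \<open>The product is the square of \<theta>(\<Phi>w) minus the square of
      \<theta>(w). As \<theta>(w)\<theta>(\<Phi>w) = 0 too, both values vanish.\<close>
    then have "(\<theta> w + \<theta> (\<Phi> x w)) * (\<theta> (\<Phi> x w) - \<theta> w) = 0"
      using prod0[of "w + \<Phi> x w"] by (simp add: linear_add[OF \<theta>] linear_diff[OF \<theta>])
    then show ?thesis using prod0[of w] by (auto simp: add_eq_0_iff)
  qed
  show "\<theta> v = \<theta> (\<xi> x) * \<eta> x v"
    using ker[of "v - \<eta> x v *\<^sub>R \<xi> x"]
    by (simp add: \<eta>_simps \<eta>_\<xi> x linear_diff[OF \<theta>] linear_scale[OF \<theta>] mult.commute)
  \<comment> \<open>The factor \<open>f\<close> is read off at (\<xi>, \<xi>), where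
    \<open>ricci_\<xi>\<close> fixes Ric.\<close>
  show "f = DIM('e) - 1 + c * (\<theta> (\<xi> x))\<^sup>2"
    using ric[of "\<xi> x" "\<xi> x"] by (simp add: ricci_\<xi> x \<eta>_\<xi> g_\<xi> power2_eq_square)
qed

end

subsection \<open>Opposite Einstein-Weyl structures\<close>

context weyl_chart
begin

lemma opposite_weyl_chart: "weyl_chart S g (\<lambda>y v. - \<theta> y v)"
proof (intro weyl_chart.intro weyl_chart_axioms.intro metric_chart_axioms)
  show "linear (\<lambda>v. - \<theta> y v)" if "y \<in> S" for y
    by (rule linear_compose_neg[OF \<theta>_linear[OF that]])
  show "smooth_on (\<lambda>y. - \<theta> y v) S" for v
    using smooth_on_scale[OF open_S \<theta>_smooth, of "-1" v] by simp
qed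

lemma opposite_einstein_weyl:
  fixes L L' :: real
  assumes x: "x \<in> S" and N: "DIM('e) > 2"
    and plus: "\<And>u v. ricci (weyl_connection g \<theta>) x u v + ricci (weyl_connection g \<theta>) x v u = L * g x u v"
    and minus: "\<And>u v. ricci (weyl_connection g (\<lambda>y v. - \<theta> y v)) x u v
      + ricci (weyl_connection g (\<lambda>y v. - \<theta> y v)) x v u = L' * g x u v"
  obtains f h where "\<And>u v. ricci \<Gamma> x u v = f * g x u v - (DIM('e) - 2) * \<theta> x u * \<theta> x v"
    and "\<And>u v. cov_\<theta> x u v + cov_\<theta> x v u = h * g x u v"
proof -
  interpret neg: weyl_chart S g "\<lambda>y v. - \<theta> y v" by (rule opposite_weyl_chart)
  have cov_neg: "neg.cov_\<theta> x u v = - cov_\<theta> x u v" for u v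
    by (simp add: neg.cov_\<theta>_def cov_\<theta>_def dd_minus d\<theta> x)
  define n where "n = real DIM('e) - 2"
  have n: "n > 0" using N by (simp add: n_def)
  \<comment> \<open>\<open>DIM('e) - 2\<close> in the statement is a subtraction of natural numbers
    under a coercion; \<open>N\<close> reconciles it with the real one.\<close>
  have n': "real (DIM('e) - 2) = n" using N by (simp add: n_def)
  \<comment> \<open>The norm of \<theta> and the divergences enter only as coefficients of
    \<open>g\<close>, so they are carried along as numbers for either sign of \<theta> and end up in
    \<open>f\<close> and \<open>h\<close>.\<close>
  define q where "q = n * \<theta> x (T x)"
  define q' where "q' = n * - \<theta> x (neg.T x)"
  define t where "t = tr (cov_T x)"
  define t' where "t' = tr (neg.cov_T x)"
  have 1: "2 * (ricci \<Gamma> x u v + n * \<theta> x u * \<theta> x v - q * g x u v)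
      - (n * (cov_\<theta> x u v + cov_\<theta> x v u) + 2 * t * g x u v) = L * g x u v" for u v
    using ricci_weyl_symmetrized[OF x, of u v] plus[of u v] by (simp add: q_def n_def t_def)
  have 2: "2 * (ricci \<Gamma> x u v + n * \<theta> x u * \<theta> x v - q' * g x u v)
      - (n * - (cov_\<theta> x u v + cov_\<theta> x v u) + 2 * t' * g x u v) = L' * g x u v" for u v
    using neg.ricci_weyl_symmetrized[OF x, of u v] minus[of u v]
    by (simp add: q'_def n_def t'_def cov_neg)
  show ?thesis
  proof (rule that)
    show "ricci \<Gamma> x u v = (L + L' + 2 * q + 2 * q' + 2 * t + 2 * t') / 4 * g x u v
        - (DIM('e) - 2) * \<theta> x u * \<theta> x v" for u v
      using 1[of u v] 2[of u v] unfolding n' by (simp add: field_simps)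
    show "cov_\<theta> x u v + cov_\<theta> x v u = (L' - L + 2 * q' - 2 * q + 2 * t' - 2 * t) / (2 * n) * g x u v" for u v
      using 1[of u v] 2[of u v] n by (simp add: field_simps)
  qed
qed

end

text \<open>Provides a nonzero vector in ker \<eta>, at which the Killing-type equation for a\<eta>
  has a vanishing left-hand side; this forces \<open>h = 0\<close>.\<close>

lemma ex_nonzero_kernel:
  fixes f :: "'e::euclidean_space \<Rightarrow> real"
  assumes f: "linear f" and N: "DIM('e) \<ge> 2"
  obtains v where "v \<noteq> 0" "f v = 0"
proof -
  obtain b c :: 'e where bc: "b \<in> Basis" "c \<in> Basis" "b \<noteq> c"
    using N card_le_Suc0_iff_eq[OF finite_Basis] by (metis not_less_eq_eq numeral_2_eq_2)
  show ?thesis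
  proof (cases "f c = 0")
    case True
    then show ?thesis using that[of c] bc(2) nonzero_Basis by blast
  next
    case False
    define v where "v = f c *\<^sub>R b - f b *\<^sub>R c"
    have "v \<bullet> b = f c" using bc by (simp add: v_def inner_diff_left inner_Basis)
    then have "v \<noteq> 0" using False by auto
    moreover have "f v = 0" by (simp add: v_def linear_diff[OF f] linear_scale[OF f])
    ultimately show ?thesis by (rule that)
  qed
qed

locale sasaki_weyl_chart = sasaki_chart S g \<xi> \<eta> \<Phi> + weyl_chart S g \<theta>
  for S :: "'e::euclidean_space set" and g :: "'e \<Rightarrow> 'e \<Rightarrow> 'e \<Rightarrow> real"
    and \<xi> :: "'e \<Rightarrow> 'e" and \<eta> :: "'e \<Rightarrow> 'e \<Rightarrow> real" and \<Phi> :: "'e \<Rightarrow> 'e \<Rightarrow> 'e"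
    and \<theta> :: "'e \<Rightarrow> 'e \<Rightarrow> real"
begin

lemma opposite_einstein_weyl_form:
  fixes L L' :: "'e \<Rightarrow> real"
  assumes N: "DIM('e) > 2"
    and plus: "\<And>y u v. y \<in> S \<Longrightarrow>
      ricci (weyl_connection g \<theta>) y u v + ricci (weyl_connection g \<theta>) y v u = L y * g y u v"
    and minus: "\<And>y u v. y \<in> S \<Longrightarrow> ricci (weyl_connection g (\<lambda>y v. - \<theta> y v)) y u v
      + ricci (weyl_connection g (\<lambda>y v. - \<theta> y v)) y v u = L' y * g y u v"
    and x: "x \<in> S"
  shows "\<theta> x v = \<theta> x (\<xi> x) * \<eta> x v"
    and "ricci \<Gamma> x u v = (DIM('e) - 1 + (DIM('e) - 2) * (\<theta> x (\<xi> x))\<^sup>2) * g x u v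
      - (DIM('e) - 2) * (\<theta> x (\<xi> x))\<^sup>2 * \<eta> x u * \<eta> x v"
    and "((\<lambda>y. \<theta> y (\<xi> y)) has_derivative (\<lambda>w. 0)) (at x)"
proof -
  define c where "c = real (DIM('e) - 2)"
  have c: "c \<noteq> 0" using N by (simp add: c_def)
  \<comment> \<open>The proportionality is needed on all of \<open>S\<close> and not only at
    \<open>x\<close>, because it is differentiated below.\<close>
  have \<theta>_eq: "\<theta> y v = \<theta> y (\<xi> y) * \<eta> y v" if y: "y \<in> S" for y v
  proof -
    obtain f h where "\<And>u v. ricci \<Gamma> y u v = f * g y u v - c * \<theta> y u * \<theta> y v"
      using opposite_einstein_weyl[OF y N plus[OF y] minus[OF y]] unfolding c_def by metis
    then show ?thesis by (rule form_proportional_\<eta>(1)[OF y \<theta>_linear[OF y] c])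
  qed
  obtain f h where ric: "\<And>u v. ricci \<Gamma> x u v = f * g x u v - c * \<theta> x u * \<theta> x v"
    and kil: "\<And>u v. cov_\<theta> x u v + cov_\<theta> x v u = h * g x u v"
    using opposite_einstein_weyl[OF x N plus[OF x] minus[OF x]] unfolding c_def by metis
  show "\<theta> x v = \<theta> x (\<xi> x) * \<eta> x v" by (rule \<theta>_eq[OF x])
  show "ricci \<Gamma> x u v = (DIM('e) - 1 + (DIM('e) - 2) * (\<theta> x (\<xi> x))\<^sup>2) * g x u v
      - (DIM('e) - 2) * (\<theta> x (\<xi> x))\<^sup>2 * \<eta> x u * \<eta> x v"
    using ric[of u v] form_proportional_\<eta>(2)[OF x \<theta>_linear[OF x] c ric] \<theta>_eq[OF x, of u] \<theta>_eq[OF x, of v]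
    by (simp add: c_def power2_eq_square)
  define a where "a y = \<theta> y (\<xi> y)" for y
  have da: "a differentiable (at x)"
    unfolding a_def by (rule dd_linear_family(1)[OF open_S x \<theta>_linear d\<theta>[OF x] d\<xi>[OF x]])
  have cov: "cov_\<theta> x u v = dd a x u * \<eta> x v - a x * g x (\<Phi> x u) v" for u v
  proof -
    have "dd (\<lambda>y. \<theta> y v) x u = dd (\<lambda>y. a y * \<eta> y v) x u"
      by (rule fun_cong[OF dd_cong(1)[OF open_S x]]) (auto simp: \<theta>_eq a_def[symmetric] intro!: differentiable_mult da d\<eta> x)
    also have "\<dots> = dd a x u * \<eta> x v + a x * (\<eta> x (\<Gamma> x u v) - g x (\<Phi> x u) v)"
      by (simp add: dd_mult da d\<eta> x dd_\<eta>)
    finally show ?thesis using \<theta>_eq[OF x, of "\<Gamma> x u v"] by (simp add: cov_\<theta>_def a_def algebra_simps)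
  qed
  \<comment> \<open>The term with \<Phi> is skew and cancels on symmetrising. Evaluation at (v, v)
    with v in ker \<eta>, at (\<xi>, \<xi>) and at (u, \<xi>) then gives in turn h = 0, da(\<xi>) =
    0 and da = 0.\<close>
  have K: "dd a x u * \<eta> x v + dd a x v * \<eta> x u = h * g x u v" for u v
    using kil[of u v] \<Phi>_skew[OF x, of u v] g_sym[OF x, of u "\<Phi> x v"] by (simp add: cov)
  obtain v where v: "v \<noteq> 0" "\<eta> x v = 0"
    by (rule ex_nonzero_kernel[OF \<eta>_linear[OF x]]) (use N in auto)
  have h: "h = 0" using K[of v v] v pos[OF x v(1)] by simp
  have a\<xi>: "dd a x (\<xi> x) = 0" using K[of "\<xi> x" "\<xi> x"] by (simp add: h \<eta>_\<xi> x)
  have "dd a x u = 0" for u using K[of u "\<xi> x"] by (simp add: h a\<xi> \<eta>_\<xi> x)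
  then have "dd a x = (\<lambda>w. 0)" by (rule ext)
  then show "((\<lambda>y. \<theta> y (\<xi> y)) has_derivative (\<lambda>w. 0)) (at x)"
    using dd_works[OF da] by (simp add: a_def[abs_def])
qed

text \<open>As \<nabla>\<eta> is skew, all terms odd in \<theta> vanish: the symmetric part of
  \<nabla>\<theta> and the divergence, a multiple of the trace of \<Phi>. Among the even ones, the
  condition on \<open>a\<close> makes \<theta> \<otimes> \<theta> cancel \<nu> \<eta> \<otimes>
  \<eta>, and the norm of \<theta> contributes \<nu> g, whence the factor
  \<open>2 * (l + \<nu>)\<close>.\<close>

lemma einstein_weyl_of_\<eta>_multiple:
  fixes a l \<nu> :: real
  assumes \<theta>: "\<And>y v. y \<in> S \<Longrightarrow> \<theta> y v = a * \<eta> y v"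
    and ric: "\<And>u v. ricci \<Gamma> x u v = l * g x u v + \<nu> * \<eta> x u * \<eta> x v"
    and a: "(real DIM('e) - 2) * a\<^sup>2 = - \<nu>" and x: "x \<in> S"
  shows "ricci (weyl_connection g \<theta>) x u v + ricci (weyl_connection g \<theta>) x v u = 2 * (l + \<nu>) * g x u v"
proof -
  have cov: "cov_\<theta> x u v = - a * g x (\<Phi> x u) v" for u v
  proof -
    have "dd (\<lambda>y. \<theta> y v) x u = dd (\<lambda>y. a * \<eta> y v) x u"
      by (rule fun_cong[OF dd_cong(1)[OF open_S x]]) (auto simp: \<theta> intro!: differentiable_mult d\<eta> x)
    also have "\<dots> = a * (\<eta> x (\<Gamma> x u v) - g x (\<Phi> x u) v)"
      by (simp add: dd_mult d\<eta> x dd_\<eta>)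
    finally show ?thesis by (simp add: cov_\<theta>_def \<theta> x algebra_simps)
  qed
  have "T x = a *\<^sub>R \<xi> x" by (rule nondegenerate[OF x]) (simp add: g_T g_simps g_\<xi> \<theta> x)
  then have \<theta>T: "\<theta> x (T x) = a\<^sup>2" by (simp add: \<theta> \<eta>_simps \<eta>_\<xi> x power2_eq_square)
  have "cov_T x = (\<lambda>u. (- a) *\<^sub>R \<Phi> x u)"
    by (intro ext nondegenerate[OF x]) (simp add: g_cov_T cov g_simps x)
  then have "tr (cov_T x) = 0" by (simp only: tr_scale tr_\<Phi>[OF x])
  moreover have "cov_\<theta> x u v + cov_\<theta> x v u = 0"
    using \<Phi>_skew[OF x, of u v] g_sym[OF x, of u "\<Phi> x v"] by (simp add: cov)
  moreover have p: "(real DIM('e) - 2) * \<theta> x u * \<theta> x v = - \<nu> * \<eta> x u * \<eta> x v"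
    by (simp add: \<theta> x power2_eq_square flip: a)
  ultimately show ?thesis
    unfolding ricci_weyl_symmetrized[OF x] \<theta>T a p by (simp add: ric algebra_simps)
qed

end

section \<open>From charts to the manifold\<close>

lemma openin_chart_image:
  assumes c: "is_chart M c" and U: "open U"
  shows "openin M {p \<in> fst c. snd c p \<in> U}"
proof -
  have o: "openin M (fst c)" and h: "continuous_map (subtopology M (fst c)) (top_of_set (coords c)) (snd c)"
    using c homeomorphic_imp_continuous_map by (auto simp: is_chart_def)
  have "openin (subtopology M (fst c)) {p \<in> topspace (subtopology M (fst c)). snd c p \<in> coords c \<inter> U}"
    by (rule openin_continuous_map_preimage[OF h openin_open_Int[OF U]])
  moreover have "{p \<in> topspace (subtopology M (fst c)). snd c p \<in> coords c \<inter> U} = {p \<in> fst c. snd c p \<in> U}"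
    using openin_subset[OF o] by (auto simp: coords_def)
  ultimately show ?thesis using openin_open_subtopology[OF o] by simp
qed

lemma chart_inj:
  assumes c: "is_chart M c" shows "inj_on (snd c) (fst c)"
proof -
  have "fst c \<subseteq> topspace M" using c openin_subset by (auto simp: is_chart_def)
  moreover have "inj_on (snd c) (topspace (subtopology M (fst c)))"
    using c homeomorphic_imp_injective_map unfolding is_chart_def by blast
  ultimately show ?thesis by (simp add: inf.absorb2)
qed

lemma param_snd: "is_chart M c \<Longrightarrow> p \<in> fst c \<Longrightarrow> param c (snd c p) = p"
  unfolding param_def by (rule inv_into_f_f[OF chart_inj])

lemma param_in: "y \<in> coords c \<Longrightarrow> param c y \<in> fst c"
  and snd_param: "y \<in> coords c \<Longrightarrow> snd c (param c y) = y"
  unfolding param_def coords_def by (rule inv_into_into f_inv_into_f, assumption)+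

text \<open>\<open>F\<close> is constant on chart preimages of balls, so the set of points where
  \<open>P (F p)\<close> holds is open for every predicate \<open>P\<close>. Taking \<open>P\<close>
  to be equality with a value and its negation makes each level set open and closed.\<close>

lemma zero_derivative_imp_constant:
  fixes F :: "'a \<Rightarrow> real" and A :: "('a, 'e::euclidean_space) chart set"
  assumes M: "smooth_manifold M A" and con: "connected_space M"
    and der: "\<And>c x. c \<in> A \<Longrightarrow> x \<in> coords c \<Longrightarrow> ((\<lambda>y. F (param c y)) has_derivative (\<lambda>w. 0)) (at x)"
  obtains k where "\<And>p. p \<in> topspace M \<Longrightarrow> F p = k"
proof -
  have chart: "is_chart M c" if "c \<in> A" for c using M that by (auto simp: smooth_manifold_def)
  have cover: "\<exists>c\<in>A. p \<in> fst c" if "p \<in> topspace M" for p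
    using M that by (auto simp: smooth_manifold_def)
  have opn: "openin M {p \<in> topspace M. P (F p)}" for P
  proof (subst openin_subopen, intro ballI)
    fix p assume p: "p \<in> {p \<in> topspace M. P (F p)}"
    then obtain c where c: "c \<in> A" "p \<in> fst c" using cover by blast
    have oc: "open (coords c)" using chart[OF c(1)] by (simp add: is_chart_def)
    have pc: "snd c p \<in> coords c" using c(2) by (simp add: coords_def)
    obtain e where e: "e > 0" "ball (snd c p) e \<subseteq> coords c" using oc pc open_contains_ball by blast
    define V where "V = {q \<in> fst c. snd c q \<in> ball (snd c p) e}"
    have "\<exists>k. \<forall>y\<in>ball (snd c p) e. F (param c y) = k"
    proof (rule has_derivative_zero_constant[OF convex_ball])
      show "((\<lambda>y. F (param c y)) has_derivative (\<lambda>w. 0)) (at y within ball (snd c p) e)"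
        if "y \<in> ball (snd c p) e" for y
        by (rule has_derivative_at_withinI[OF der[OF c(1)]]) (use e that in blast)
    qed
    then obtain k where k: "\<And>y. y \<in> ball (snd c p) e \<Longrightarrow> F (param c y) = k" by blast
    have Fk: "F q = k" if "q \<in> V" for q
      using k[of "snd c q"] that param_snd[OF chart[OF c(1)]] by (auto simp: V_def)
    have pV: "p \<in> V" using c e by (simp add: V_def)
    have "openin M V" unfolding V_def by (rule openin_chart_image[OF chart[OF c(1)] open_ball])
    moreover from this have "V \<subseteq> {p \<in> topspace M. P (F p)}"
      using Fk Fk[OF pV] p openin_subset[of M V] by auto
    ultimately show "\<exists>T. openin M T \<and> p \<in> T \<and> T \<subseteq> {p \<in> topspace M. P (F p)}" using pV by blast
  qed
  show ?thesis
  proof (cases "topspace M = {}")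
    case True
    then show ?thesis using that by simp
  next
    case False
    then obtain p0 where p0: "p0 \<in> topspace M" by blast
    define U where "U = {p \<in> topspace M. F p = F p0}"
    have "topspace M - U = {p \<in> topspace M. F p \<noteq> F p0}" by (auto simp: U_def)
    then have "closedin M U" using opn[of "\<lambda>r. r \<noteq> F p0"] by (auto simp: closedin_def U_def)
    then have "U = {} \<or> U = topspace M"
      using con opn[of "\<lambda>r. r = F p0"] unfolding connected_space_clopen_in U_def by blast
    then show ?thesis using p0 that[of "F p0"] by (auto simp: U_def)
  qed
qed

lemma sasaki_chart_coords:
  assumes M: "smooth_manifold M A" and sas: "sasakian A n \<xi> \<eta> \<Phi> g" and c: "c \<in> A"
  shows "sasaki_chart (coords c) (g c) (\<xi> c) (\<eta> c) (\<Phi> c)"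
proof -
  have "riemannian_metric A g" using sas by (simp add: sasakian_def)
  then have met: "\<forall>x\<in>coords c. bilinear (g c x) \<and> (\<forall>u v. g c x u v = g c x v u) \<and> (\<forall>v. v \<noteq> 0 \<longrightarrow> g c x v v > 0)"
    and smooth: "\<forall>u v. smooth_on (\<lambda>x. g c x u v) (coords c)"
    using c unfolding riemannian_metric_def by fast+
  have lin: "\<forall>x\<in>coords c. linear (\<eta> c x)" "\<forall>x\<in>coords c. linear (\<Phi> c x)"
    and sm: "smooth_on (\<xi> c) (coords c)" "\<forall>v. smooth_on (\<lambda>x. \<eta> c x v) (coords c)"
      "\<forall>v. smooth_on (\<lambda>x. \<Phi> c x v) (coords c)"
    using sas c unfolding sasakian_def vector_field_def contact_form_def one_form_def endo_field_def by fast+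
  have alg: "\<forall>x\<in>coords c. \<eta> c x (\<xi> c x) = 1 \<and>
        (\<forall>v. \<Phi> c x (\<Phi> c x v) = - v + \<eta> c x v *\<^sub>R \<xi> c x) \<and>
        (\<forall>u v. g c x (\<Phi> c x u) (\<Phi> c x v) = g c x u v - \<eta> c x u * \<eta> c x v) \<and>
        (\<forall>u v. cov_endo (\<Phi> c) x (levi_civita (g c) x) u v = g c x u v *\<^sub>R \<xi> c x - \<eta> c x v *\<^sub>R u)"
    using sas c unfolding sasakian_def by fast
  have "open (coords c)" using M c unfolding smooth_manifold_def is_chart_def by blast
  then have "metric_chart (coords c) (g c)"
    by (rule metric_chart.intro) (use met smooth in blast)+
  then show ?thesis
    by (rule sasaki_chart.intro, intro sasaki_chart_axioms.intro) (use lin sm alg in blast)+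
qed

lemma one_form_scale:
  assumes M: "smooth_manifold M A" and "one_form A \<eta>"
  shows "one_form A (\<lambda>c x v. a * \<eta> c x v)"
  unfolding one_form_def
proof (intro conjI ballI allI)
  fix c x v assume c: "c \<in> A"
  show "linear (\<lambda>v. a * \<eta> c x v)" if "x \<in> coords c"
    using assms c that linear_compose_scale_right[of "\<eta> c x" a] by (auto simp: one_form_def)
  have "open (coords c)" using M c by (auto simp: smooth_manifold_def is_chart_def)
  then show "smooth_on (\<lambda>x. a * \<eta> c x v) (coords c)"
    using assms c by (auto simp: one_form_def intro!: smooth_on_scale)
  show "a * \<eta> d (transition c d x) (dtrans c d x v) = a * \<eta> c x v"
    if "d \<in> A" "x \<in> overlap c d" for d
    using assms c that by (auto simp: one_form_def)
qed

theorem theorem63: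
  fixes M :: "'a topology"
    and A :: "('a, 'e::euclidean_space) chart set"
    and n :: nat
    and \<xi> :: "('a, 'e) vfield" and \<eta> :: "('a, 'e) form1"
    and \<Phi> :: "('a, 'e) endofield" and g :: "('a, 'e) bilfield"
  assumes "smooth_manifold M A" and "connected_space M" and "topspace M \<noteq> {}"
    and "sasakian A n \<xi> \<eta> \<Phi> g"
    and "2 * n + 1 \<ge> 5"
  shows "(\<exists>\<theta>. (\<exists>c\<in>A. \<exists>x\<in>coords c. \<exists>v. \<theta> c x v \<noteq> 0) \<and>
            einstein_weyl A g \<theta> \<and> einstein_weyl A g (\<lambda>c x v. - \<theta> c x v)) \<longleftrightarrow>
         (\<exists>l \<nu>. eta_einstein A \<eta> g l \<nu> \<and> \<nu> < 0)"
proof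
  note M = assms(1) and sas = assms(4)
  have N: "DIM('e) > 2" using sas assms(5) by (simp add: sasakian_def)
  assume "\<exists>\<theta>. (\<exists>c\<in>A. \<exists>x\<in>coords c. \<exists>v. \<theta> c x v \<noteq> 0) \<and>
            einstein_weyl A g \<theta> \<and> einstein_weyl A g (\<lambda>c x v. - \<theta> c x v)"
  then obtain \<theta> where nz: "\<exists>c\<in>A. \<exists>x\<in>coords c. \<exists>v. \<theta> c x v \<noteq> 0"
    and ew: "einstein_weyl A g \<theta>" "einstein_weyl A g (\<lambda>c x v. - \<theta> c x v)" by blast
  obtain L where L: "\<And>c x u v. c \<in> A \<Longrightarrow> x \<in> coords c \<Longrightarrow>
      ricci (weyl_connection (g c) (\<theta> c)) x u v + ricci (weyl_connection (g c) (\<theta> c)) x v u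
      = L (param c x) * g c x u v"
    using ew(1) unfolding einstein_weyl_def by blast
  obtain L' where L': "\<And>c x u v. c \<in> A \<Longrightarrow> x \<in> coords c \<Longrightarrow>
      ricci (weyl_connection (g c) (\<lambda>x v. - \<theta> c x v)) x u v
      + ricci (weyl_connection (g c) (\<lambda>x v. - \<theta> c x v)) x v u
      = L' (param c x) * g c x u v"
    using ew(2) unfolding einstein_weyl_def by blast
  have \<theta>: "one_form A \<theta>" using ew(1) by (simp add: einstein_weyl_def)
  have chart: "is_chart M c" if "c \<in> A" for c using M that by (auto simp: smooth_manifold_def)
  have swc: "sasaki_weyl_chart (coords c) (g c) (\<xi> c) (\<eta> c) (\<Phi> c) (\<theta> c)" if c: "c \<in> A" for c
  proof -
    interpret sasaki_chart "coords c" "g c" "\<xi> c" "\<eta> c" "\<Phi> c" by (rule sasaki_chart_coords[OF M sas c])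
    show ?thesis
      by (intro sasaki_weyl_chart.intro weyl_chart.intro weyl_chart_axioms.intro sasaki_chart_axioms
          metric_chart_axioms) (use \<theta> c in \<open>auto simp: one_form_def\<close>)
  qed
  have local: "\<theta> c x v = \<theta> c x (\<xi> c x) * \<eta> c x v"
    "ricci (levi_civita (g c)) x u v = (DIM('e) - 1 + (DIM('e) - 2) * (\<theta> c x (\<xi> c x))\<^sup>2) * g c x u v
      - (DIM('e) - 2) * (\<theta> c x (\<xi> c x))\<^sup>2 * \<eta> c x u * \<eta> c x v"
    "((\<lambda>y. \<theta> c y (\<xi> c y)) has_derivative (\<lambda>w. 0)) (at x)"
    if c: "c \<in> A" and x: "x \<in> coords c" for c x u v
    by (rule sasaki_weyl_chart.opposite_einstein_weyl_form[OF swc[OF c] N L[OF c] L'[OF c] x], assumption+)+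
  \<comment> \<open>\<theta>(\<xi>) as a function on the manifold, evaluated in an arbitrarily
    chosen chart around each point. The transformation laws of \<theta> and \<xi> make the choice
    immaterial.\<close>
  define F where "F p = (let c = SOME c. c \<in> A \<and> p \<in> fst c in \<theta> c (snd c p) (\<xi> c (snd c p)))" for p
  have F: "F (param c x) = \<theta> c x (\<xi> c x)" if c: "c \<in> A" and x: "x \<in> coords c" for c x
  proof -
    define p where "p = param c x"
    have p: "p \<in> fst c" "snd c p = x" using x by (auto simp: p_def param_in snd_param)
    define d where "d = (SOME d. d \<in> A \<and> p \<in> fst d)"
    have d: "d \<in> A" "p \<in> fst d"
      using someI[of "\<lambda>d. d \<in> A \<and> p \<in> fst d" c] c p by (auto simp: d_def)
    have ov: "x \<in> overlap c d" using p d by (auto simp: overlap_def)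
    have tx: "transition c d x = snd d p" by (simp add: transition_def p_def)
    have "\<xi> d (snd d p) = dtrans c d x (\<xi> c x)"
      using sas c d(1) ov unfolding tx[symmetric] sasakian_def vector_field_def by blast
    moreover have "\<theta> d (snd d p) (dtrans c d x v) = \<theta> c x v" for v
      using \<theta> c d(1) ov unfolding tx[symmetric] one_form_def by blast
    ultimately have "F p = \<theta> c x (\<xi> c x)" by (simp add: F_def d_def[symmetric])
    then show ?thesis by (simp add: p_def)
  qed
  obtain k where k: "\<And>p. p \<in> topspace M \<Longrightarrow> F p = k"
  proof (rule zero_derivative_imp_constant[OF M assms(2), of F])
    fix c x assume c: "c \<in> A" and x: "x \<in> coords c"
    have "open (coords c)" using chart[OF c] by (simp add: is_chart_def)
    from has_derivative_transform_within_open[OF local(3)[OF c x] this x]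
    show "((\<lambda>y. F (param c y)) has_derivative (\<lambda>w. 0)) (at x)" by (simp add: F c)
  qed blast
  have \<theta>k: "\<theta> c x (\<xi> c x) = k" if "c \<in> A" "x \<in> coords c" for c x
  proof -
    have "param c x \<in> topspace M"
      using param_in[OF that(2)] chart[OF that(1)] openin_subset by (force simp: is_chart_def)
    then show ?thesis using F[OF that] k by simp
  qed
  \<comment> \<open>Here the non-triviality of \<theta> enters: \<theta> = k\<eta> would vanish
    everywhere for k = 0.\<close>
  have "k \<noteq> 0" using nz local(1) \<theta>k by (metis mult_zero_left)
  then have "- (real (DIM('e) - 2) * k\<^sup>2) < 0" using N by simp
  moreover have "eta_einstein A \<eta> g (DIM('e) - 1 + (DIM('e) - 2) * k\<^sup>2) (- ((DIM('e) - 2) * k\<^sup>2))"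
    unfolding eta_einstein_def using local(2) \<theta>k by simp
  ultimately show "\<exists>l \<nu>. eta_einstein A \<eta> g l \<nu> \<and> \<nu> < 0" by blast
next
  note M = assms(1) and sas = assms(4)
  have N: "DIM('e) > 2" using sas assms(5) by (simp add: sasakian_def)
  assume "\<exists>l \<nu>. eta_einstein A \<eta> g l \<nu> \<and> \<nu> < 0"
  then obtain l \<nu> where ee: "eta_einstein A \<eta> g l \<nu>" and \<nu>: "\<nu> < 0" by blast
  define a where "a = sqrt (- \<nu> / (real DIM('e) - 2))"
  have a: "(real DIM('e) - 2) * a\<^sup>2 = - \<nu>" "a \<noteq> 0" using N \<nu> by (auto simp: a_def field_simps)
  have \<eta>: "one_form A \<eta>" and g: "riemannian_metric A g"
    using sas by (auto simp: sasakian_def contact_form_def)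
  \<comment> \<open>The condition on \<open>b\<close> involves only its square, so \<open>a\<close>
    and \<open>- a\<close> both qualify and yield the two opposite structures.\<close>
  have ew: "einstein_weyl A g (\<lambda>c x v. b * \<eta> c x v)" if b: "(real DIM('e) - 2) * b\<^sup>2 = - \<nu>" for b
    unfolding einstein_weyl_def
  proof (intro conjI exI[of _ "\<lambda>p. 2 * (l + \<nu>)"] ballI allI)
    show of: "one_form A (\<lambda>c x v. b * \<eta> c x v)" by (rule one_form_scale[OF M \<eta>])
    show "smooth_function A (\<lambda>p. 2 * (l + \<nu>))"
      by (simp add: smooth_function_def o_def smooth_on_const)
    fix c x u v assume c: "c \<in> A" and x: "x \<in> coords c"
    interpret sasaki_chart "coords c" "g c" "\<xi> c" "\<eta> c" "\<Phi> c" by (rule sasaki_chart_coords[OF M sas c])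
    interpret sasaki_weyl_chart "coords c" "g c" "\<xi> c" "\<eta> c" "\<Phi> c" "\<lambda>x v. b * \<eta> c x v"
      by (intro sasaki_weyl_chart.intro weyl_chart.intro weyl_chart_axioms.intro sasaki_chart_axioms
          metric_chart_axioms) (use of c in \<open>auto simp: one_form_def\<close>)
    show "ricci (weyl_connection (g c) (\<lambda>x v. b * \<eta> c x v)) x u v
        + ricci (weyl_connection (g c) (\<lambda>x v. b * \<eta> c x v)) x v u = 2 * (l + \<nu>) * g c x u v"
      by (rule einstein_weyl_of_\<eta>_multiple[OF refl _ b x])
         (use ee c x in \<open>auto simp: eta_einstein_def\<close>)
  qed (rule g)
  \<comment> \<open>Non-triviality of a\<eta> is witnessed at any point of the nonempty manifold by
    \<eta>(\<xi>) = 1.\<close>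
  obtain p where "p \<in> topspace M" using assms(3) by blast
  then have "p \<in> \<Union> (fst ` A)" using M by (simp add: smooth_manifold_def)
  then obtain c where c: "c \<in> A" "p \<in> fst c" by blast
  then have x: "snd c p \<in> coords c" by (simp add: coords_def)
  have "\<eta> c (snd c p) (\<xi> c (snd c p)) = 1" using sas c x by (auto simp: sasakian_def)
  then have "\<exists>c\<in>A. \<exists>x\<in>coords c. \<exists>v. a * \<eta> c x v \<noteq> 0" using a(2) c x by (metis mult_1_right)
  moreover have "einstein_weyl A g (\<lambda>c x v. - (a * \<eta> c x v))" using ew[of "- a"] a by simp
  ultimately show "\<exists>\<theta>. (\<exists>c\<in>A. \<exists>x\<in>coords c. \<exists>v. \<theta> c x v \<noteq> 0) \<and>
            einstein_weyl A g \<theta> \<and> einstein_weyl A g (\<lambda>c x v. - \<theta> c x v)"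
    using ew[OF a(1)] by (intro exI[of _ "\<lambda>c x v. a * \<eta> c x v"] conjI)
qed

end
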